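(* Let $B_1=B_1(0)\subset\mathbb{R}^n$ be the open unit ball. Let $u\in C^3(\overline{B_1})$ be a solution of $$\sum_{i=1}^n\arctan\lambda_i(x)=\psi(x),\qquad x\in B_1,$$ where $\lambda_1(x),\dots,\lambda_n(x)$ are the eigenvalues of the Hessian $D^2u(x)$, and where $\psi\in C^2(B_1)$ satisfies $\psi\ge (n-2)\frac{\pi}{2}$ on $B_1$. Then $$|Du(0)|\le C\left(1+(\operatorname{osc}_{B_1}u)^2\right),$$ where $C=C(n,\|D^2\psi\|_{L^\infty(B_1)})$ is a constant depending only on $n$ and $\|D^2\psi\|_{L^\infty(B_1)}$.
   Context: $\operatorname{osc}_{B_1}u=\sup_{B_1}u-\inf_{B_1}u$. $\|D^2\psi\|_{L^\infty(B_1)}$ denotes the supremum over $B_1$ of the absolute values of the eigenvalues of $D^2\psi$. *)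

theory Defs
  imports "HOL-Analysis.Analysis" "HOL-Computational_Algebra.Polynomial"
begin

section \<open>Partial derivatives and differentiability classes\<close>

definition partial_deriv :: "'n \<Rightarrow> (real ^ 'n \<Rightarrow> real) \<Rightarrow> real ^ 'n \<Rightarrow> real" where
  "partial_deriv i f x = frechet_derivative f (at x) (axis i 1)"

fun iter_partial_deriv :: "'n list \<Rightarrow> (real ^ 'n \<Rightarrow> real) \<Rightarrow> real ^ 'n \<Rightarrow> real" where
  "iter_partial_deriv [] f = f"
| "iter_partial_deriv (i # is) f = partial_deriv i (iter_partial_deriv is f)"

text \<open>Both classes below are meant for open \<open>S\<close>. Then iterated partial derivatives at points of
  \<open>S\<close> depend only on the values of the function on \<open>S\<close>, and \<open>differentiable_on\<close> means
  differentiability at every point of \<open>S\<close>.\<close>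

definition C_k_on :: "nat \<Rightarrow> (real ^ 'n \<Rightarrow> real) \<Rightarrow> (real ^ 'n) set \<Rightarrow> bool" where
  "C_k_on k f S \<longleftrightarrow>
     (\<forall>is. length is < k \<longrightarrow> iter_partial_deriv is f differentiable_on S) \<and>
     (\<forall>is. length is \<le> k \<longrightarrow> continuous_on S (iter_partial_deriv is f))"

text \<open>The class \<open>C\<^sup>k\<close> on the closure of \<open>S\<close>: all partial derivatives of order at most \<open>k\<close> in \<open>S\<close>
  extend continuously to the closure, the function itself being its own extension.\<close>

definition C_k_on_closure :: "nat \<Rightarrow> (real ^ 'n \<Rightarrow> real) \<Rightarrow> (real ^ 'n) set \<Rightarrow> bool" where
  "C_k_on_closure k f S \<longleftrightarrow>
     C_k_on k f S \<and> continuous_on (closure S) f \<and>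
     (\<forall>is. length is \<le> k \<longrightarrow>
        (\<exists>g. continuous_on (closure S) g \<and> (\<forall>x\<in>S. g x = iter_partial_deriv is f x)))"

definition grad :: "(real ^ 'n \<Rightarrow> real) \<Rightarrow> real ^ 'n \<Rightarrow> real ^ 'n" where
  "grad f x = (\<chi> i. partial_deriv i f x)"

definition hessian :: "(real ^ 'n \<Rightarrow> real) \<Rightarrow> real ^ 'n \<Rightarrow> real ^ 'n ^ 'n" where
  "hessian f x = (\<chi> i j. iter_partial_deriv [i, j] f x)"


section \<open>Eigenvalues\<close>

definition charpoly :: "real ^ 'n ^ 'n \<Rightarrow> real poly" where
  "charpoly A = det (\<chi> i j. (if i = j then [:0, 1:] else 0) - [:A $ i $ j:])"

text \<open>The real eigenvalues, listed with algebraic multiplicity. For a symmetric matrix these are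
  all \<open>n\<close> eigenvalues.\<close>

definition eigenvalues :: "real ^ 'n ^ 'n \<Rightarrow> real multiset" where
  "eigenvalues A = proots (charpoly A)"

lemma poly_charpoly: "poly (charpoly A) l = det (mat l - A)"
  unfolding charpoly_def det_def
  by (auto simp: poly_sum poly_prod mat_def intro!: sum.cong prod.cong)

lemma poly_charpoly_eq_0_iff:
  fixes A :: "real ^ 'n ^ 'n"
  shows "poly (charpoly A) l = 0 \<longleftrightarrow> (\<exists>v. v \<noteq> 0 \<and> A *v v = l *\<^sub>R v)"
proof -
  have *: "mat l *v v = l *\<^sub>R v" for v :: "real ^ 'n"
    by (simp add: matrix_vector_mult_def mat_def vec_eq_iff if_distrib[of "\<lambda>x. x * _"]
        cong: if_cong)
  have "poly (charpoly A) l = 0 \<longleftrightarrow> \<not> invertible (mat l - A)"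
    by (simp add: poly_charpoly invertible_det_nz)
  also have "\<dots> \<longleftrightarrow> (\<exists>v. (mat l - A) *v v = 0 \<and> v \<noteq> 0)"
    by (simp add: invertible_left_inverse matrix_left_invertible_ker)
  also have "\<dots> \<longleftrightarrow> (\<exists>v. v \<noteq> 0 \<and> A *v v = l *\<^sub>R v)"
    by (simp add: matrix_vector_mult_diff_rdistrib * eq_commute[of "l *\<^sub>R _"] conj_commute)
  finally show ?thesis .
qed

lemma charpoly_nonzero: "charpoly A \<noteq> 0"
proof
  assume "charpoly A = 0"
  define l where "l = onorm ((*v) A) + 1"
  obtain v where v: "v \<noteq> 0" "A *v v = l *\<^sub>R v"
    using poly_charpoly_eq_0_iff[of A l] \<open>charpoly A = 0\<close> by auto
  have "bounded_linear ((*v) A)"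
    by (simp add: matrix_vector_mul_bounded_linear)
  then have "norm (A *v v) \<le> onorm ((*v) A) * norm v" "0 \<le> onorm ((*v) A)"
    by (rule onorm, rule onorm_pos_le)
  then have "\<bar>l\<bar> * norm v \<le> (l - 1) * norm v"
    using v by (simp add: l_def)
  with v(1) show False
    by simp
qed

lemma in_eigenvalues_iff: "l \<in># eigenvalues A \<longleftrightarrow> (\<exists>v. v \<noteq> 0 \<and> A *v v = l *\<^sub>R v)"
  by (simp add: eigenvalues_def charpoly_nonzero poly_charpoly_eq_0_iff)


section \<open>Oscillation and the norm of the Hessian\<close>

definition osc :: "'a set \<Rightarrow> ('a \<Rightarrow> real) \<Rightarrow> real" where
  "osc S f = (SUP x\<in>S. f x) - (INF x\<in>S. f x)"

definition abs_hessian_eigenvalues :: "(real ^ 'n) set \<Rightarrow> (real ^ 'n \<Rightarrow> real) \<Rightarrow> real set" where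
  "abs_hessian_eigenvalues S f = {\<bar>l\<bar> | x l. x \<in> S \<and> l \<in># eigenvalues (hessian f x)}"

text \<open>Only meaningful if \<open>abs_hessian_eigenvalues S f\<close> is bounded above.\<close>

definition hessian_sup_norm :: "(real ^ 'n) set \<Rightarrow> (real ^ 'n \<Rightarrow> real) \<Rightarrow> real" where
  "hessian_sup_norm S f = Sup (abs_hessian_eigenvalues S f)"

end

theory Submission
  imports Defs
begin

text \<open>The estimate is a maximum principle argument for the function
  \<open>W = \<eta> |Du| + (n / L) w\<^sup>2\<close> on the ball of radius \<open>1/2\<close>, where \<open>\<eta> = 1/4 - |x|\<^sup>2\<close>,
  \<open>L = 1 + osc u\<close>, and \<open>w\<close> is \<open>u\<close> shifted by a constant so that \<open>L \<le> w \<le> 2 L\<close>. On the boundary,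
  where \<open>\<eta>\<close> vanishes, \<open>W \<le> 4 n L\<close>. So a large \<open>|Du(0)|\<close> forces the maximum to be taken at an
  interior point \<open>x0\<close>, and it remains to show \<open>\<eta> |Du| \<le> C L\<^sup>2\<close> there. Near \<open>x0\<close> the norm \<open>|Du|\<close> is
  replaced by the directional derivative \<open>Du \<bullet> e\<close> with \<open>e = Du(x0) / |Du(x0)|\<close>, which is smooth, is
  at most \<open>|Du|\<close>, and agrees with it at \<open>x0\<close>; the maximum at \<open>x0\<close> persists.

  Write \<open>p = |Du(x0)|\<close> and work in an orthonormal eigenbasis of \<open>D\<^sup>2u(x0)\<close>. In an eigendirection in
  which \<open>e\<close> has a component of size at least \<open>1 / sqrt n\<close>, the vanishing of \<open>DW\<close> says that the
  eigenvalue is a negative number \<open>-r\<close> with \<open>\<eta> r\<close> between \<open>n p\<close> and \<open>5 n p\<close>. The phase being at least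
  \<open>(n - 2) \<pi>/2\<close>, a very negative eigenvalue has two consequences: all other eigenvalues are at least
  \<open>r\<close>, and the phase exceeds \<open>(n - 2) \<pi>/2\<close> by at most \<open>1 / r\<close>. The second one is where the Hessian of
  \<open>\<psi>\<close> enters: a function bounded below whose second derivatives are bounded has small slope
  wherever it is close to its lower bound, so the derivative of \<open>\<psi>\<close> in direction \<open>e\<close> is at least
  \<open>-C / sqrt r\<close>.

  Finally, the second derivatives of \<open>W\<close> at \<open>x0\<close> in the eigendirections are summed with the weights
  \<open>1 / (1 + \<lambda>\<^sub>k\<^sup>2)\<close>, the coefficients of the linearised equation. The third derivatives of \<open>u\<close> then
  combine to the derivative of \<open>\<psi>\<close>. The good term, from the gradient squared in the Hessian of
  \<open>w\<^sup>2\<close>, is of size \<open>p\<^sup>2 / (L r\<^sup>2)\<close>, hence \<open>\<eta>\<^sup>2 / L\<close>; the worst bad term is the one of \<open>\<psi>\<close>, of size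
  \<open>\<eta> / sqrt r\<close>, hence \<open>\<eta>\<^sup>2 / sqrt (\<eta> p)\<close>. Comparing them gives \<open>sqrt (\<eta> p) \<le> C L\<close>.

  Eigenvalues need not depend differentiably on the matrix, so the equation is differentiated
  through a determinant: for symmetric \<open>A\<close>, the complex number \<open>det (1 + i A)\<close> is the product of the
  \<open>1 + i \<lambda>\<^sub>k\<close>, and its argument is the sum of the \<open>arctan \<lambda>\<^sub>k\<close> (lemma \<open>det_phase\<close>, theorem
  \<open>phase_derivative\<close>). The analytic core is \<open>interior_max_estimate\<close>.\<close>

section \<open>Diagonalising symmetric matrices\<close>

definition orthonormal :: "('i \<Rightarrow> real ^ 'n) \<Rightarrow> bool" where
  "orthonormal v \<longleftrightarrow> (\<forall>i j. v i \<bullet> v j = (if i = j then 1 else 0))"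

lemma inner_symmetric_matrix:
  fixes A :: "real ^ 'n ^ 'n"
  assumes "transpose A = A"
  shows "x \<bullet> (A *v y) = y \<bullet> (A *v x)"
  by (metis assms dot_lmul_matrix inner_commute transpose_matrix_vector)

text \<open>A maximiser \<open>v\<close> of the quadratic form on the unit sphere of the subspace is an eigenvector: the
  residual \<open>w = A v - l v\<close> lies in the subspace again, and on the line from \<open>v\<close> in its direction
  \<open>x \<bullet> A x - l |x|\<^sup>2\<close>, which is zero at \<open>v\<close> and never positive, starts with slope \<open>2 |w|\<^sup>2\<close>.\<close>

lemma eigenvector_in_invariant_subspace:
  fixes A :: "real ^ 'n ^ 'n"
  assumes sym: "transpose A = A" and S: "subspace S" "\<And>x. x \<in> S \<Longrightarrow> A *v x \<in> S"
    and y: "y \<in> S" "y \<noteq> 0"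
  obtains v l where "v \<in> S" "norm v = 1" "A *v v = l *\<^sub>R v"
proof -
  let ?K = "S \<inter> sphere 0 1"
  have "compact ?K"
    by (simp add: closed_Int_compact closed_subspace S(1))
  moreover have "(1 / norm y) *\<^sub>R y \<in> ?K"
    using y S(1) by (simp add: subspace_scale)
  then have "?K \<noteq> {}" by blast
  moreover have "continuous_on ?K (\<lambda>x. x \<bullet> (A *v x))"
    by (intro continuous_intros linear_continuous_on matrix_vector_mul_bounded_linear)
  ultimately have "\<exists>v\<in>?K. \<forall>x\<in>?K. x \<bullet> (A *v x) \<le> v \<bullet> (A *v v)"
    by (rule continuous_attains_sup)
  then obtain v where v: "v \<in> ?K" and max: "\<And>x. x \<in> ?K \<Longrightarrow> x \<bullet> (A *v x) \<le> v \<bullet> (A *v v)"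
    by blast
  define l where "l = v \<bullet> (A *v v)"
  define w where "w = A *v v - l *\<^sub>R v"
  have wS: "w \<in> S"
    using v S unfolding w_def by (auto intro: subspace_diff subspace_scale)
  have vv: "v \<bullet> v = 1" using v by (simp add: dot_square_norm)
  have quad: "x \<bullet> (A *v x) \<le> l * (x \<bullet> x)" if "x \<in> S" for x
  proof (cases "x = 0")
    case False
    then have "(1 / norm x) *\<^sub>R x \<in> ?K"
      using that S(1) by (simp add: subspace_scale)
    from max[OF this] have "(x \<bullet> (A *v x)) / (norm x)\<^sup>2 \<le> l"
      by (simp add: l_def matrix_vector_mult_scaleR power2_eq_square)
    then show ?thesis
      using False by (simp add: divide_simps dot_square_norm)
  qed simp
  have ww: "w \<bullet> w = w \<bullet> (A *v v) - l * (w \<bullet> v)"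
    by (subst (2) w_def) (simp add: inner_diff_right)
  have "2 * t * (w \<bullet> w) + t\<^sup>2 * (w \<bullet> (A *v w) - l * (w \<bullet> w)) \<le> 0" for t
  proof -
    have "v + t *\<^sub>R w \<in> S"
      using v wS S(1) by (auto intro: subspace_add subspace_scale)
    from quad[OF this]
    have "v \<bullet> (A *v v) + t * (v \<bullet> (A *v w)) + t * (w \<bullet> (A *v v)) + t\<^sup>2 * (w \<bullet> (A *v w))
        \<le> l * (v \<bullet> v + 2 * t * (w \<bullet> v) + t\<^sup>2 * (w \<bullet> w))"
      by (simp add: algebra_simps matrix_vector_mult_scaleR matrix_vector_right_distrib
          inner_commute power2_eq_square)
    then show ?thesis
      unfolding ww inner_symmetric_matrix[OF sym, of v w]
      by (simp add: algebra_simps vv l_def[symmetric])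
  qed note pert = this
  have "w = 0"
  proof (rule ccontr)
    assume "w \<noteq> 0"
    define c where "c = \<bar>w \<bullet> (A *v w) - l * (w \<bullet> w)\<bar> + 1"
    have pos: "w \<bullet> w > 0" "c > 0" using \<open>w \<noteq> 0\<close> by (auto simp: c_def)
    \<comment> \<open>small enough for the linear term of the perturbation to beat the quadratic one\<close>
    define t where "t = (w \<bullet> w) / c"
    have "t > 0" using pos by (simp add: t_def)
    have "t\<^sup>2 * (- c) \<le> t\<^sup>2 * (w \<bullet> (A *v w) - l * (w \<bullet> w))"
      by (intro mult_left_mono) (auto simp: c_def)
    moreover have "t\<^sup>2 * c = t * (w \<bullet> w)"
      using pos by (simp add: t_def power2_eq_square)
    ultimately have "t * (w \<bullet> w) \<le> 0"
      using pert[of t] by simp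
    then show False using \<open>t > 0\<close> pos by (simp add: mult_le_0_iff)
  qed
  then show ?thesis
    using that[of v l] v by (simp add: w_def)
qed

text \<open>An orthonormal set of eigenvectors of maximal size spans the space; otherwise its orthogonal
  complement, which is invariant under a symmetric matrix, would contain a further eigenvector.\<close>

theorem symmetric_orthonormal_eigenbasis:
  fixes A :: "real ^ 'n ^ 'n"
  assumes sym: "transpose A = A"
  obtains v :: "'n \<Rightarrow> real ^ 'n" and l where "orthonormal v" "\<And>i. A *v v i = l i *\<^sub>R v i"
proof -
  define P where "P B \<longleftrightarrow> pairwise orthogonal B \<and> (\<forall>b\<in>B. norm b = 1 \<and> (\<exists>l. A *v b = l *\<^sub>R b))"
    for B :: "(real ^ 'n) set"
  have card: "finite B \<and> card B \<le> CARD('n)" if "P B" for B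
  proof -
    have "independent B"
      using that by (intro pairwise_orthogonal_independent) (auto simp: P_def)
    then show ?thesis using independent_bound by auto
  qed
  have "P {}" by (simp add: P_def)
  moreover have "\<forall>B. P B \<longrightarrow> card B < Suc CARD('n)"
    using card by (simp add: less_Suc_eq_le)
  ultimately have "\<exists>B. P B \<and> (\<forall>B'. P B' \<longrightarrow> card B' \<le> card B)"
    by (rule Lattices_Big.ex_has_greatest_nat)
  then obtain B where B: "P B" and maxB: "\<And>B'. P B' \<Longrightarrow> card B' \<le> card B"
    by auto
  have fin: "finite B" using card[OF B] by blast
  have "card B = CARD('n)"
  proof (rule ccontr)
    assume "card B \<noteq> CARD('n)"
    then have "card B < DIM(real ^ 'n)" using card[OF B] by simp
    with dim_le_card'[OF fin] have "dim B < DIM(real ^ 'n)"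
      by (rule le_less_trans)
    then obtain y where y: "y \<noteq> 0" "\<And>b. b \<in> span B \<Longrightarrow> orthogonal y b"
      by (rule orthogonal_to_subspace_exists) blast
    define S where "S = {x. \<forall>b\<in>B. b \<bullet> x = 0}"
    have "subspace S"
      by (auto simp: S_def subspace_def inner_add_right)
    moreover have "A *v x \<in> S" if "x \<in> S" for x
    proof -
      have "b \<bullet> (A *v x) = 0" if "b \<in> B" for b
      proof -
        obtain l where "A *v b = l *\<^sub>R b" using B \<open>b \<in> B\<close> by (auto simp: P_def)
        then show ?thesis
          using \<open>x \<in> S\<close> \<open>b \<in> B\<close> by (subst inner_symmetric_matrix[OF sym]) (simp add: S_def inner_commute)
      qed
      then show ?thesis by (simp add: S_def)
    qed
    moreover have "y \<in> S"
      using y(2) by (auto simp: S_def span_base orthogonal_def inner_commute)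
    ultimately obtain v l where v: "v \<in> S" "norm v = 1" "A *v v = l *\<^sub>R v"
      using eigenvector_in_invariant_subspace[OF sym] y(1) by metis
    then have "v \<notin> B" by (auto simp: S_def dot_square_norm)
    moreover have "P (insert v B)"
      using B v by (auto simp: P_def S_def pairwise_insert orthogonal_def inner_commute)
    ultimately show False
      using maxB[of "insert v B"] fin by simp
  qed
  then obtain v where v: "bij_betw v (UNIV :: 'n set) B"
    using fin by (metis finite_class.finite_UNIV finite_same_card_bij)
  have vB: "v i \<in> B" for i using v by (auto simp: bij_betw_def)
  then have "\<forall>i. \<exists>l. A *v v i = l *\<^sub>R v i"
    using B by (auto simp: P_def)
  then obtain l where l: "\<And>i. A *v v i = l i *\<^sub>R v i" by metis
  have "v i \<bullet> v j = (if i = j then 1 else 0)" for i j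
  proof (cases "i = j")
    case True
    then show ?thesis using B vB[of j] by (auto simp: P_def dot_square_norm)
  next
    case False
    then have "v i \<noteq> v j" using v by (auto simp: bij_betw_def inj_on_def)
    then show ?thesis
      using B vB[of i] vB[of j] False by (auto simp: P_def pairwise_def orthogonal_def)
  qed
  then show ?thesis using that l unfolding orthonormal_def by blast
qed

lemma orthonormal_expansion:
  fixes v :: "'n \<Rightarrow> real ^ 'n"
  assumes "orthonormal v"
  shows "(\<Sum>k\<in>UNIV. (x \<bullet> v k) * (y \<bullet> v k)) = x \<bullet> y"
proof -
  let ?Q = "\<chi> i. v i"
  have "?Q ** transpose ?Q = mat 1"
    using assms by (simp add: vec_eq_iff matrix_matrix_mult_def transpose_def mat_def
        orthonormal_def inner_vec_def)
  then have "transpose ?Q ** ?Q = mat 1"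
    using matrix_left_right_inverse by blast
  then have "x \<bullet> y = x \<bullet> (transpose ?Q *v (?Q *v y))"
    by (simp add: matrix_vector_mul_assoc)
  also have "\<dots> = (?Q *v x) \<bullet> (?Q *v y)"
    by (metis dot_lmul_matrix inner_commute transpose_matrix_vector transpose_transpose)
  also have "\<dots> = (\<Sum>k\<in>UNIV. (x \<bullet> v k) * (y \<bullet> v k))"
    by (simp add: inner_vec_def[of "?Q *v x"] matrix_vector_mul_component inner_commute)
  finally show ?thesis by simp
qed

text \<open>Orthogonal invariance of \<open>det (a + b A)\<close>. Two cases are of interest: real scalars for the
  characteristic polynomial, and \<open>det (1 + i A)\<close>, where the matrix is real but the scalars are not.\<close>

lemma det_orthonormal_change:
  fixes v :: "'n \<Rightarrow> real ^ 'n" and A :: "real ^ 'n ^ 'n" and a b :: "'a :: {real_algebra_1, comm_ring_1}"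
  assumes v: "orthonormal v"
  shows "det (\<chi> j k. a * of_bool (j = k) + b * of_real (v j \<bullet> (A *v v k)))
       = det (\<chi> j k. a * of_bool (j = k) + b * of_real (A $ j $ k))"
proof -
  define Q :: "'a ^ 'n ^ 'n" where "Q = (\<chi> i j. of_real (v i $ j))"
  let ?M = "(\<chi> j k. a * of_bool (j = k) + b * of_real (A $ j $ k)) :: 'a ^ 'n ^ 'n"
  have dot: "(\<Sum>k\<in>UNIV. of_real (x $ k) * of_real (y $ k)) = (of_real (x \<bullet> y) :: 'a)"
    for x y :: "real ^ 'n"
    by (simp add: inner_vec_def)
  have QQ: "Q ** transpose Q = mat 1"
    using v by (simp add: vec_eq_iff matrix_matrix_mult_def transpose_def mat_def Q_def
        orthonormal_def dot)
  have row: "(\<Sum>m\<in>UNIV. ?M $ l $ m * of_real (x $ m)) = a * of_real (x $ l) + b * of_real ((A *v x) $ l)"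
    for l and x :: "real ^ 'n"
  proof -
    have "(\<Sum>m\<in>UNIV. ?M $ l $ m * of_real (x $ m))
        = (\<Sum>m\<in>UNIV. if l = m then a * of_real (x $ m) else 0)
        + (\<Sum>m\<in>UNIV. b * (of_real (A $ l $ m) * of_real (x $ m)))"
      unfolding sum.distrib[symmetric] by (intro sum.cong) (auto simp: distrib_right mult.assoc)
    then show ?thesis
      by (simp add: matrix_vector_mult_def sum_distrib_left)
  qed
  have N: "Q ** (?M ** transpose Q)
      = (\<chi> j k. a * of_bool (j = k) + b * of_real (v j \<bullet> (A *v v k)))" (is "_ = ?N")
  proof -
    have "(Q ** (?M ** transpose Q)) $ j $ k = ?N $ j $ k" for j k
    proof -
      have "(Q ** (?M ** transpose Q)) $ j $ k
          = (\<Sum>l\<in>UNIV. of_real (v j $ l) * (\<Sum>m\<in>UNIV. ?M $ l $ m * of_real (v k $ m)))"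
        by (simp add: matrix_matrix_mult_def transpose_def Q_def)
      also have "\<dots> = (\<Sum>l\<in>UNIV. a * (of_real (v j $ l) * of_real (v k $ l))
          + b * (of_real (v j $ l) * of_real ((A *v v k) $ l)))"
        unfolding row by (simp add: distrib_left mult_ac)
      also have "\<dots> = a * of_real (v j \<bullet> v k) + b * of_real (v j \<bullet> (A *v v k))"
        by (simp only: sum.distrib sum_distrib_left[symmetric] dot)
      finally show ?thesis
        using v by (simp add: orthonormal_def)
    qed
    then show ?thesis by (simp add: vec_eq_iff)
  qed
  have "det ?N = det Q * (det ?M * det (transpose Q))"
    unfolding N[symmetric] det_mul ..
  also have "\<dots> = det (Q ** transpose Q) * det ?M"
    unfolding det_mul by (simp add: mult_ac)
  finally show ?thesis by (simp add: QQ)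
qed

lemma eigenvalues_eigenbasis:
  fixes v :: "'n \<Rightarrow> real ^ 'n"
  assumes v: "orthonormal v" and l: "\<And>i. A *v v i = l i *\<^sub>R v i"
  shows "eigenvalues A = image_mset l (mset_set UNIV)"
proof -
  have vAv: "v j \<bullet> (A *v v k) = l k * of_bool (j = k)" for j k
    using v by (simp add: l orthonormal_def)
  have "poly (charpoly A) c = poly (\<Prod>i\<in>UNIV. [:- l i, 1:]) c" for c
  proof -
    have "poly (charpoly A) c = det (\<chi> j k. c * of_bool (j = k) + (- 1) * of_real (A $ j $ k))"
      unfolding poly_charpoly by (rule arg_cong[of _ _ det]) (simp add: vec_eq_iff mat_def)
    also have "\<dots> = det (\<chi> j k. c * of_bool (j = k) + (- 1) * of_real (v j \<bullet> (A *v v k)))"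
      by (rule det_orthonormal_change[OF v, symmetric])
    also have "\<dots> = (\<Prod>i\<in>UNIV. c - l i)"
      by (subst det_diagonal) (auto simp: vAv)
    finally show ?thesis by (simp add: poly_prod)
  qed
  then have "charpoly A = (\<Prod>i\<in>UNIV. [:- l i, 1:])"
    by (simp add: poly_eq_poly_eq_iff[symmetric] fun_eq_iff)
  then show ?thesis
    by (simp add: eigenvalues_def proots_prod sum_unfold_sum_mset image_mset.compositionality)
qed

text \<open>This is how the phase becomes accessible to differentiation: \<open>det (1 + i A)\<close> is a polynomial in
  the entries of \<open>A\<close>, whereas the eigenvalues are not even differentiable in general. In an
  eigenbasis the determinant is the product of the \<open>1 + i \<lambda>\<^sub>k\<close>, which have arguments \<open>arctan \<lambda>\<^sub>k\<close>. The
  basis \<open>v\<close> is arbitrary, so that a basis adapted to one matrix can be used for its neighbours.\<close>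

lemma det_phase:
  fixes A :: "real ^ 'n ^ 'n" and v :: "'n \<Rightarrow> real ^ 'n"
  assumes sym: "transpose A = A" and v: "orthonormal v"
  shows "\<exists>r>0. det (\<chi> j k. of_bool (j = k) + \<i> * complex_of_real (v j \<bullet> (A *v v k)))
    = of_real r * cis (\<Sum>l\<in>#eigenvalues A. arctan l)"
proof -
  obtain w :: "'n \<Rightarrow> real ^ 'n" and l where w: "orthonormal w" and l: "\<And>i. A *v w i = l i *\<^sub>R w i"
    using symmetric_orthonormal_eigenbasis[OF sym] by blast
  have wAw: "w j \<bullet> (A *v w k) = l k * of_bool (j = k)" for j k
    using w by (simp add: l orthonormal_def)
  have factor: "1 + \<i> * complex_of_real x = of_real (sqrt (1 + x\<^sup>2)) * cis (arctan x)" for x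
  proof -
    have "1 + x\<^sup>2 > 0" by (simp add: add_pos_nonneg)
    then show ?thesis by (simp add: complex_eq_iff cos_arctan sin_arctan)
  qed
  have cis_sum: "(\<Prod>i\<in>S. cis (f i)) = cis (\<Sum>i\<in>S. f i)" for f :: "'n \<Rightarrow> real" and S
    by (induction S rule: infinite_finite_induct) (auto simp: cis_mult)
  have "det (\<chi> j k. of_bool (j = k) + \<i> * complex_of_real (v j \<bullet> (A *v v k)))
      = det (\<chi> j k. of_bool (j = k) + \<i> * complex_of_real (w j \<bullet> (A *v w k)))"
    using det_orthonormal_change[OF v, of 1 \<i> A] det_orthonormal_change[OF w, of 1 \<i> A] by simp
  also have "\<dots> = (\<Prod>i\<in>UNIV. 1 + \<i> * complex_of_real (l i))"
    by (subst det_diagonal) (auto simp: wAw)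
  also have "\<dots> = of_real (\<Prod>i\<in>UNIV. sqrt (1 + (l i)\<^sup>2)) * cis (\<Sum>i\<in>UNIV. arctan (l i))"
    by (simp add: factor prod.distrib cis_sum)
  also have "(\<Sum>i\<in>UNIV. arctan (l i)) = (\<Sum>l\<in>#eigenvalues A. arctan l)"
    by (simp add: eigenvalues_eigenbasis[OF w l] sum_unfold_sum_mset image_mset.compositionality o_def)
  finally show ?thesis
    by (intro exI[of _ "\<Prod>i\<in>UNIV. sqrt (1 + (l i)\<^sup>2)"]) (auto intro!: prod_pos add_pos_nonneg)
qed

section \<open>Differentiating the phase\<close>

text \<open>Only the identity permutation contributes to the derivative: any other one picks at least two
  off-diagonal entries, and one of these is left after differentiating a single factor.\<close>

lemma has_vector_derivative_det_diagonal:
  fixes N :: "real \<Rightarrow> complex ^ 'n ^ 'n"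
  assumes der: "\<And>j k. ((\<lambda>t. N t $ j $ k) has_vector_derivative N' j k) (at t0)"
    and diag: "\<And>j k. j \<noteq> k \<Longrightarrow> N t0 $ j $ k = 0"
    and nz: "\<And>k. N t0 $ k $ k \<noteq> 0"
  shows "((\<lambda>t. det (N t)) has_vector_derivative
    det (N t0) * (\<Sum>k\<in>UNIV. N' k k / N t0 $ k $ k)) (at t0)"
proof -
  let ?U = "UNIV :: 'n set"
  let ?P = "{p. p permutes ?U}"
  define D where "D p = of_int (sign p) * (\<Sum>i\<in>?U. N' i (p i) * (\<Prod>j\<in>?U - {i}. N t0 $ j $ p j))" for p
  have deriv_term: "((\<lambda>t. of_int (sign p) * (\<Prod>i\<in>?U. N t $ i $ p i)) has_vector_derivative D p) (at t0)" for p
  proof -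
    have "((\<lambda>t. \<Prod>i\<in>?U. N t $ i $ p i) has_derivative
        (\<lambda>h. \<Sum>i\<in>?U. (h *\<^sub>R N' i (p i)) * (\<Prod>j\<in>?U - {i}. N t0 $ j $ p j))) (at t0)"
      by (rule has_derivative_prod) (use der in \<open>simp add: has_vector_derivative_def\<close>)
    then have "((\<lambda>t. \<Prod>i\<in>?U. N t $ i $ p i) has_vector_derivative
        (\<Sum>i\<in>?U. N' i (p i) * (\<Prod>j\<in>?U - {i}. N t0 $ j $ p j))) (at t0)"
      by (simp add: has_vector_derivative_def scaleR_sum_right)
    then show ?thesis
      unfolding D_def by (rule has_vector_derivative_mult_right)
  qed
  have D0: "D p = 0" if p: "p permutes ?U" "p \<noteq> id" for p
  proof -
    have "(\<Prod>j\<in>?U - {i}. N t0 $ j $ p j) = 0" for i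
    proof -
      obtain j where j: "p j \<noteq> j" using p(2) by (auto simp: fun_eq_iff)
      have "p (p j) \<noteq> p j" using permutes_inj[OF p(1)] j by (auto dest: injD)
      then obtain m where "m \<noteq> i" "p m \<noteq> m" using j by metis
      then show ?thesis
        using diag[of m "p m"] by (intro prod_zero) auto
    qed
    then show ?thesis
      by (simp only: D_def mult_zero_right sum.neutral_const)
  qed
  have "((\<lambda>t. \<Sum>p\<in>?P. of_int (sign p) * (\<Prod>i\<in>?U. N t $ i $ p i)) has_vector_derivative
      (\<Sum>p\<in>?P. D p)) (at t0)"
    by (rule has_vector_derivative_sum) (rule deriv_term)
  moreover have "(\<Sum>p\<in>?P. D p) = D id"
    using D0 by (subst sum.remove[of _ id]) (auto simp: finite_permutations permutes_id)
  moreover have "D id = det (N t0) * (\<Sum>k\<in>?U. N' k k / N t0 $ k $ k)"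
  proof -
    have "(\<Prod>j\<in>?U - {i}. N t0 $ j $ j) = det (N t0) / N t0 $ i $ i" for i
      using nz[of i] by (subst det_diagonal[OF diag]) (auto simp: prod.remove[of ?U i])
    then show ?thesis
      by (simp add: D_def sum_distrib_left mult_ac)
  qed
  ultimately show ?thesis
    unfolding det_def by simp
qed

text \<open>The linearisation of the operator \<open>H \<mapsto> \<Sum> arctan \<lambda>\<^sub>k(H)\<close>, in an eigenbasis of \<open>H t0\<close>. With \<open>N t\<close> the
  matrix \<open>1 + i H t\<close> in that basis, \<open>det (N t) cis (- \<phi> t)\<close> is real and positive for \<open>t\<close> near \<open>t0\<close>. So its
  logarithmic derivative \<open>S - i \<phi>'\<close> at \<open>t0\<close> has imaginary part zero, where \<open>S\<close> is the sum of the
  \<open>i H'\<^sub>k\<^sub>k / (1 + i l\<^sub>k)\<close>.\<close>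

theorem phase_derivative:
  fixes H :: "real \<Rightarrow> real ^ 'n ^ 'n" and v :: "'n \<Rightarrow> real ^ 'n"
  assumes ev: "eventually (\<lambda>t. transpose (H t) = H t \<and> (\<Sum>l\<in>#eigenvalues (H t). arctan l) = \<phi> t) (nhds t0)"
    and H': "\<And>i j. ((\<lambda>t. H t $ i $ j) has_real_derivative H' $ i $ j) (at t0)"
    and \<phi>': "(\<phi> has_real_derivative \<phi>') (at t0)"
    and v: "orthonormal v" and l: "\<And>i. H t0 *v v i = l i *\<^sub>R v i"
  shows "(\<Sum>k\<in>UNIV. (v k \<bullet> (H' *v v k)) / (1 + (l k)\<^sup>2)) = \<phi>'"
proof -
  define N where "N t = (\<chi> j k. of_bool (j = k) + \<i> * complex_of_real (v j \<bullet> (H t *v v k)))" for t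
  have N': "((\<lambda>t. N t $ j $ k) has_vector_derivative \<i> * of_real (v j \<bullet> (H' *v v k))) (at t0)" for j k
  proof -
    have "((\<lambda>t. v j \<bullet> (H t *v v k)) has_real_derivative v j \<bullet> (H' *v v k)) (at t0)"
      unfolding inner_vec_def matrix_vector_mult_def by (auto intro!: derivative_eq_intros H' simp: mult.commute)
    then have "((\<lambda>t. complex_of_real (v j \<bullet> (H t *v v k))) has_vector_derivative
        of_real (v j \<bullet> (H' *v v k))) (at t0)"
      by (simp add: has_real_derivative_iff_has_vector_derivative has_vector_derivative_of_real)
    from has_vector_derivative_add[OF has_vector_derivative_const has_vector_derivative_mult_right[OF this]]
    show ?thesis by (simp add: N_def)
  qed
  have N0: "N t0 $ j $ k = (1 + \<i> * of_real (l k)) * of_bool (j = k)" for j k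
    using v by (simp add: N_def l orthonormal_def)
  have nz: "1 + \<i> * complex_of_real x \<noteq> 0" for x
    by (simp add: complex_eq_iff)
  define S where "S = (\<Sum>k\<in>UNIV. \<i> * of_real (v k \<bullet> (H' *v v k)) / N t0 $ k $ k)"
  have D: "((\<lambda>t. det (N t)) has_vector_derivative det (N t0) * S) (at t0)"
    unfolding S_def by (rule has_vector_derivative_det_diagonal[OF N']) (auto simp: N0 nz)
  have E: "((\<lambda>t. cis (- \<phi> t)) has_vector_derivative - \<i> * of_real \<phi>' * cis (- \<phi> t0)) (at t0)"
  proof -
    have "((\<lambda>t. complex_of_real (- \<phi> t)) has_vector_derivative of_real (- \<phi>')) (at t0)"
      using DERIV_minus[OF \<phi>']
      by (simp add: has_real_derivative_iff_has_vector_derivative has_vector_derivative_of_real del: of_real_minus)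
    from field_vector_diff_chain_at[OF has_vector_derivative_mult_right[OF this, of \<i>] DERIV_exp]
    show ?thesis by (simp add: o_def cis_conv_exp mult_ac)
  qed
  have deriv: "((\<lambda>t. Im (det (N t) * cis (- \<phi> t))) has_real_derivative
      Im (det (N t0) * (- \<i> * of_real \<phi>' * cis (- \<phi> t0)) + det (N t0) * S * cis (- \<phi> t0))) (at t0)"
    using bounded_linear.has_vector_derivative[OF bounded_linear_Im has_vector_derivative_mult[OF D E]]
    by (simp only: has_real_derivative_iff_has_vector_derivative)
  have real: "\<exists>r>0. det (N t) * cis (- \<phi> t) = of_real r"
    if t: "transpose (H t) = H t" "(\<Sum>l\<in>#eigenvalues (H t). arctan l) = \<phi> t" for t
  proof -
    obtain r where "r > 0" "det (N t) = of_real r * cis (\<phi> t)"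
      using det_phase[OF t(1) v] t(2) by (auto simp: N_def)
    then show ?thesis by (auto simp: mult.assoc cis_mult)
  qed
  have "eventually (\<lambda>t. Im (det (N t) * cis (- \<phi> t)) = 0) (nhds t0)"
    using ev by eventually_elim (use real in fastforce)
  from iffD1[OF DERIV_cong_ev[OF refl this refl] deriv] DERIV_const
  have "Im (det (N t0) * (- \<i> * of_real \<phi>' * cis (- \<phi> t0)) + det (N t0) * S * cis (- \<phi> t0)) = 0"
    by (rule DERIV_unique)
  also have "det (N t0) * (- \<i> * of_real \<phi>' * cis (- \<phi> t0)) + det (N t0) * S * cis (- \<phi> t0)
      = (det (N t0) * cis (- \<phi> t0)) * (S - \<i> * of_real \<phi>')"
    by (simp add: algebra_simps)
  finally have "Im (det (N t0) * cis (- \<phi> t0) * (S - \<i> * of_real \<phi>')) = 0" .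
  moreover obtain r where "r > 0" "det (N t0) * cis (- \<phi> t0) = of_real r"
    using real[of t0] eventually_nhds_x_imp_x[OF ev] by blast
  ultimately have "Im S = \<phi>'"
    by simp
  moreover have "Im S = (\<Sum>k\<in>UNIV. (v k \<bullet> (H' *v v k)) / (1 + (l k)\<^sup>2))"
    by (simp add: S_def N0 Im_divide power2_eq_square)
  ultimately show ?thesis by simp
qed

section \<open>Partial derivatives along lines\<close>

lemma has_derivative_grad:
  assumes "f differentiable (at x)"
  shows "(f has_derivative (\<lambda>v. grad f x \<bullet> v)) (at x)"
proof -
  have D: "(f has_derivative frechet_derivative f (at x)) (at x)"
    using assms frechet_derivative_works by blast
  then have lin: "linear (frechet_derivative f (at x))"
    by (rule has_derivative_linear)
  have "frechet_derivative f (at x) v = grad f x \<bullet> v" for v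
  proof -
    have "frechet_derivative f (at x) v = frechet_derivative f (at x) (\<Sum>i\<in>UNIV. v $ i *\<^sub>R axis i 1)"
      using basis_expansion[of v] by (simp add: scalar_mult_eq_scaleR)
    also have "\<dots> = (\<Sum>i\<in>UNIV. v $ i * frechet_derivative f (at x) (axis i 1))"
      by (simp add: linear_sum[OF lin] linear_scale[OF lin])
    finally show ?thesis
      by (simp add: inner_vec_def grad_def partial_deriv_def mult.commute)
  qed
  then have "frechet_derivative f (at x) = (\<lambda>v. grad f x \<bullet> v)" by blast
  with D show ?thesis by simp
qed

lemma DERIV_along_line:
  assumes "f differentiable (at (x + t *\<^sub>R v))"
  shows "((\<lambda>t. f (x + t *\<^sub>R v)) has_real_derivative grad f (x + t *\<^sub>R v) \<bullet> v) (at t)"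
proof -
  have "((\<lambda>t. x + t *\<^sub>R v) has_derivative (\<lambda>s. s *\<^sub>R v)) (at t)"
    by (auto intro!: derivative_eq_intros)
  from diff_chain_at[OF this has_derivative_grad[OF assms]]
  show ?thesis
    by (simp add: has_field_derivative_def o_def mult_commute_abs)
qed

lemma grad_inner_axis: "grad f x \<bullet> axis i 1 = partial_deriv i f x"
  by (simp add: inner_axis grad_def)

lemma partial_deriv_cong_open:
  assumes "open S" "x \<in> S" "\<And>y. y \<in> S \<Longrightarrow> f y = g y"
  shows "partial_deriv i f x = partial_deriv i g x"
proof -
  have "(f has_derivative D) (at x) = (g has_derivative D) (at x)" for D
    using assms has_derivative_transform_within_open[of f D x UNIV S g]
      has_derivative_transform_within_open[of g D x UNIV S f] by metis
  then show ?thesis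
    by (simp add: partial_deriv_def frechet_derivative_def)
qed

text \<open>The mean value theorem is applied twice, first in direction \<open>i\<close> to the increment of \<open>f\<close> in
  direction \<open>j\<close>, then in direction \<open>j\<close> to the partial derivative \<open>i\<close>.\<close>

lemma second_difference_eq_mixed_partial:
  fixes f :: "real ^ 'n \<Rightarrow> real"
  assumes f: "\<And>y. y \<in> ball x r \<Longrightarrow> f differentiable (at y)"
    and fi: "\<And>y. y \<in> ball x r \<Longrightarrow> partial_deriv i f differentiable (at y)"
    and h: "0 < h" "2 * h < r"
  shows "\<exists>y. dist x y \<le> 2 * h \<and>
    f (x + h *\<^sub>R axis i 1 + h *\<^sub>R axis j 1) - f (x + h *\<^sub>R axis i 1) - f (x + h *\<^sub>R axis j 1) + f x
      = h\<^sup>2 * partial_deriv j (partial_deriv i f) y"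
proof -
  define a b :: "real ^ 'n" where "a = axis i 1" and "b = axis j 1"
  have near: "dist x (x + s *\<^sub>R a + t *\<^sub>R b) \<le> 2 * h" if "0 \<le> s" "s \<le> h" "0 \<le> t" "t \<le> h" for s t
  proof -
    have "norm (s *\<^sub>R a + t *\<^sub>R b) \<le> s + t"
      by (rule order_trans[OF norm_triangle_ineq]) (use that in \<open>simp add: a_def b_def\<close>)
    moreover have "dist x (x + s *\<^sub>R a + t *\<^sub>R b) = norm (s *\<^sub>R a + t *\<^sub>R b)"
      by (metis add.assoc add_diff_cancel_left' dist_commute dist_norm)
    ultimately show ?thesis using that by simp
  qed
  have inball: "x + s *\<^sub>R a + t *\<^sub>R b \<in> ball x r" if "0 \<le> s" "s \<le> h" "0 \<le> t" "t \<le> h" for s t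
    using near[OF that] h(2) by simp
  define \<phi> where "\<phi> s = f (x + h *\<^sub>R b + s *\<^sub>R a) - f (x + s *\<^sub>R a)" for s
  have "(\<phi> has_real_derivative
      partial_deriv i f (x + h *\<^sub>R b + s *\<^sub>R a) - partial_deriv i f (x + s *\<^sub>R a)) (at s)"
    if "0 \<le> s" "s \<le> h" for s
    unfolding \<phi>_def grad_inner_axis[symmetric] a_def[symmetric]
    using inball[of s h] inball[of s 0] that h
    by (intro DERIV_diff DERIV_along_line f) (auto simp: add_ac)
  from MVT2[OF h(1) this] obtain s where s: "0 < s" "s < h" and
    \<phi>: "\<phi> h - \<phi> 0 = h * (partial_deriv i f (x + h *\<^sub>R b + s *\<^sub>R a) - partial_deriv i f (x + s *\<^sub>R a))"
    by auto
  have "((\<lambda>t. partial_deriv i f (x + s *\<^sub>R a + t *\<^sub>R b)) has_real_derivative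
      partial_deriv j (partial_deriv i f) (x + s *\<^sub>R a + t *\<^sub>R b)) (at t)"
    if "0 \<le> t" "t \<le> h" for t
    unfolding grad_inner_axis[of "partial_deriv i f" _ j, symmetric] b_def[symmetric]
    using inball[of s t] that s by (intro DERIV_along_line fi) auto
  from MVT2[OF h(1) this] obtain t where t: "0 < t" "t < h" and
    "partial_deriv i f (x + s *\<^sub>R a + h *\<^sub>R b) - partial_deriv i f (x + s *\<^sub>R a)
      = h * partial_deriv j (partial_deriv i f) (x + s *\<^sub>R a + t *\<^sub>R b)"
    by auto
  with \<phi> have "\<phi> h - \<phi> 0 = h\<^sup>2 * partial_deriv j (partial_deriv i f) (x + s *\<^sub>R a + t *\<^sub>R b)"
    by (simp add: add_ac power2_eq_square)
  moreover have "x + h *\<^sub>R b + h *\<^sub>R a = x + h *\<^sub>R a + h *\<^sub>R b"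
    by (simp add: add_ac)
  then have "\<phi> h - \<phi> 0
      = f (x + h *\<^sub>R a + h *\<^sub>R b) - f (x + h *\<^sub>R a) - f (x + h *\<^sub>R b) + f x"
    by (simp only: \<phi>_def scaleR_zero_left add_0_right)
  moreover have "dist x (x + s *\<^sub>R a + t *\<^sub>R b) \<le> 2 * h"
    using near[of s t] s t by simp
  ultimately show ?thesis
    unfolding a_def[symmetric] b_def[symmetric] by metis
qed

lemma C_k_on_differentiable:
  assumes "C_k_on k f S" "open S" "x \<in> S" "length is < k"
  shows "iter_partial_deriv is f differentiable (at x)"
  using assms by (auto simp: C_k_on_def differentiable_on_eq_differentiable_at)

text \<open>The second difference over a square of side \<open>h\<close> does not depend on the order of the two
  directions, and equals \<open>h\<^sup>2\<close> times either mixed partial derivative at some point near \<open>x\<close>;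
  continuity of these derivatives yields the claim as \<open>h\<close> tends to zero.\<close>

theorem mixed_partials_commute:
  fixes f :: "real ^ 'n \<Rightarrow> real"
  assumes f: "C_k_on 2 f S" and S: "open S" "x \<in> S"
  shows "partial_deriv i (partial_deriv j f) x = partial_deriv j (partial_deriv i f) x"
proof -
  have d0: "f differentiable (at y)" if "y \<in> S" for y
    using C_k_on_differentiable[OF f S(1) that, of "[]"] by simp
  have d1: "partial_deriv k f differentiable (at y)" if "y \<in> S" for y k
    using C_k_on_differentiable[OF f S(1) that, of "[k]"] by simp
  have c2: "isCont (partial_deriv k (partial_deriv l f)) x" for k l
  proof -
    have "continuous_on S (iter_partial_deriv [k, l] f)"
      using f unfolding C_k_on_def by (elim conjE allE[of _ "[k, l]"]) simp
    then show ?thesis using S by (simp add: continuous_on_eq_continuous_at)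
  qed
  obtain r where r: "r > 0" "ball x r \<subseteq> S"
    using S openE by blast
  define A where "A = partial_deriv i (partial_deriv j f)"
  define B where "B = partial_deriv j (partial_deriv i f)"
  have "\<bar>A x - B x\<bar> \<le> 2 * e" if "e > 0" for e
  proof -
    obtain r1 where r1: "r1 > 0" "\<And>y. dist y x < r1 \<Longrightarrow> dist (A y) (A x) < e"
      using c2[of i j] \<open>e > 0\<close> unfolding A_def continuous_at_eps_delta by blast
    obtain r2 where r2: "r2 > 0" "\<And>y. dist y x < r2 \<Longrightarrow> dist (B y) (B x) < e"
      using c2[of j i] \<open>e > 0\<close> unfolding B_def continuous_at_eps_delta by blast
    define h where "h = min r (min r1 r2) / 4"
    have h: "0 < h" "2 * h < r" "2 * h < r1" "2 * h < r2"
      using r(1) r1(1) r2(1) by (auto simp: h_def)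
    have "\<exists>y. dist x y \<le> 2 * h \<and>
      f (x + h *\<^sub>R axis i 1 + h *\<^sub>R axis j 1) - f (x + h *\<^sub>R axis i 1) - f (x + h *\<^sub>R axis j 1) + f x
      = h\<^sup>2 * B y"
      unfolding B_def
      by (rule second_difference_eq_mixed_partial[OF _ _ h(1,2)]) (use r(2) d0 d1 in blast)+
    then obtain y where y: "dist x y \<le> 2 * h"
      "f (x + h *\<^sub>R axis i 1 + h *\<^sub>R axis j 1) - f (x + h *\<^sub>R axis i 1) - f (x + h *\<^sub>R axis j 1) + f x
      = h\<^sup>2 * B y" by blast
    have "\<exists>z. dist x z \<le> 2 * h \<and>
      f (x + h *\<^sub>R axis j 1 + h *\<^sub>R axis i 1) - f (x + h *\<^sub>R axis j 1) - f (x + h *\<^sub>R axis i 1) + f x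
      = h\<^sup>2 * A z"
      unfolding A_def
      by (rule second_difference_eq_mixed_partial[OF _ _ h(1,2)]) (use r(2) d0 d1 in blast)+
    then obtain z where z: "dist x z \<le> 2 * h"
      "f (x + h *\<^sub>R axis j 1 + h *\<^sub>R axis i 1) - f (x + h *\<^sub>R axis j 1) - f (x + h *\<^sub>R axis i 1) + f x
      = h\<^sup>2 * A z" by blast
    have swap: "x + h *\<^sub>R axis j 1 + h *\<^sub>R axis i 1 = x + h *\<^sub>R axis i 1 + h *\<^sub>R axis j 1"
      by simp
    have "h\<^sup>2 * B y = h\<^sup>2 * A z"
      using y(2) z(2) unfolding swap by linarith
    then have "B y = A z" using h(1) by simp
    moreover have "dist (B y) (B x) < e" using r2(2)[of y] y(1) h(4) by (simp add: dist_commute)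
    moreover have "dist (A z) (A x) < e" using r1(2)[of z] z(1) h(3) by (simp add: dist_commute)
    ultimately show ?thesis by (simp add: dist_real_def)
  qed
  note close = this
  have "A x = B x"
  proof (rule ccontr)
    assume "A x \<noteq> B x"
    then show False using close[of "\<bar>A x - B x\<bar> / 4"] by simp
  qed
  then show ?thesis by (simp add: A_def B_def)
qed

lemma C_k_on_partial_deriv:
  assumes "C_k_on (Suc k) f S"
  shows "C_k_on k (partial_deriv j f) S"
proof -
  have "iter_partial_deriv is (partial_deriv j f) = iter_partial_deriv (is @ [j]) f" for "is"
    by (induction "is") auto
  then show ?thesis
    using assms by (auto simp: C_k_on_def)
qed

lemma C_k_on_mono: "C_k_on k f S \<Longrightarrow> m \<le> k \<Longrightarrow> C_k_on m f S"
  by (auto simp: C_k_on_def)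

lemma transpose_hessian:
  assumes "C_k_on 2 f S" "open S" "x \<in> S"
  shows "transpose (hessian f x) = hessian f x"
  using mixed_partials_commute[OF assms] by (simp add: hessian_def transpose_def vec_eq_iff)

lemma DERIV_grad_along_line:
  assumes f: "C_k_on 2 f S" "open S" "x + t *\<^sub>R v \<in> S"
  shows "((\<lambda>t. grad f (x + t *\<^sub>R v) \<bullet> e) has_real_derivative e \<bullet> (hessian f (x + t *\<^sub>R v) *v v)) (at t)"
proof -
  let ?y = "x + t *\<^sub>R v"
  have "((\<lambda>t. partial_deriv j f (x + t *\<^sub>R v)) has_real_derivative (hessian f ?y *v v) $ j) (at t)" for j
  proof -
    have "grad (partial_deriv j f) ?y \<bullet> v = (hessian f ?y *v v) $ j"
      using mixed_partials_commute[OF f, of _ j]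
      by (simp add: inner_vec_def grad_def hessian_def matrix_vector_mult_def)
    then show ?thesis
      using DERIV_along_line[of "partial_deriv j f" x t v] C_k_on_differentiable[OF f, of "[j]"] by simp
  qed
  note D = this
  have "((\<lambda>t. \<Sum>j\<in>UNIV. partial_deriv j f (x + t *\<^sub>R v) * e $ j) has_real_derivative
      (\<Sum>j\<in>UNIV. (hessian f ?y *v v) $ j * e $ j)) (at t)"
    by (intro DERIV_sum DERIV_cmult_right D)
  then show ?thesis
    by (simp add: inner_vec_def grad_def mult.commute)
qed

definition hessian_deriv :: "(real ^ 'n \<Rightarrow> real) \<Rightarrow> real ^ 'n \<Rightarrow> real ^ 'n \<Rightarrow> real ^ 'n ^ 'n" where
  "hessian_deriv f x e = (\<chi> i j. grad (\<lambda>y. hessian f y $ i $ j) x \<bullet> e)"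

lemma DERIV_hessian_along_line:
  assumes f: "C_k_on 3 f S" "open S" "x + t *\<^sub>R e \<in> S"
  shows "((\<lambda>t. hessian f (x + t *\<^sub>R e) $ i $ j) has_real_derivative
    hessian_deriv f (x + t *\<^sub>R e) e $ i $ j) (at t)"
proof -
  have "(\<lambda>y. hessian f y $ i $ j) differentiable (at (x + t *\<^sub>R e))"
    using C_k_on_differentiable[OF f, of "[i, j]"] by (simp add: hessian_def)
  from DERIV_along_line[OF this] show ?thesis
    by (simp add: hessian_deriv_def)
qed

text \<open>The maximum principle produces the derivative of the Hessian in direction \<open>v\<close>, the linearised
  equation the one in direction \<open>e\<close>; symmetry of the third derivatives identifies the two.\<close>

lemma hessian_deriv_symmetric:
  assumes f: "C_k_on 3 f S" "open S" "x \<in> S"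
  shows "e \<bullet> (hessian_deriv f x v *v v) = v \<bullet> (hessian_deriv f x e *v v)"
proof -
  define T where "T a b c = iter_partial_deriv [a, b, c] f x" for a b c
  have f2: "C_k_on 2 f S" using C_k_on_mono[OF f(1)] by simp
  have T1: "T a b c = T a c b" for a b c
    using partial_deriv_cong_open[OF f(2,3) mixed_partials_commute[OF f2 f(2), of _ b c], where i = a]
    by (simp add: T_def)
  have "C_k_on 2 (partial_deriv c f) S" for c
    using f(1) by (intro C_k_on_partial_deriv) (simp add: eval_nat_numeral)
  then have T2: "T a b c = T b a c" for a b c
    using mixed_partials_commute[OF _ f(2,3), of "partial_deriv c f" a b] by (simp add: T_def)
  have perm: "T a c b = T c b a" for a b c
    using T2[of a c b] T1[of c a b] by simp
  have H: "hessian_deriv f x w $ i $ j = (\<Sum>k\<in>UNIV. w $ k * T k i j)" for w i j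
    by (simp add: hessian_deriv_def inner_vec_def grad_def hessian_def T_def mult.commute)
  have "e \<bullet> (hessian_deriv f x v *v v) = (\<Sum>c\<in>UNIV. \<Sum>b\<in>UNIV. \<Sum>a\<in>UNIV. e $ c * v $ b * v $ a * T a c b)"
    by (simp add: inner_vec_def[of e] matrix_vector_mult_def H sum_distrib_left sum_distrib_right mult_ac)
  also have "\<dots> = (\<Sum>c\<in>UNIV. \<Sum>b\<in>UNIV. \<Sum>a\<in>UNIV. e $ c * v $ b * v $ a * T c b a)"
    by (intro sum.cong refl arg_cong2[where f = "(*)"] perm)
  also have "\<dots> = (\<Sum>b\<in>UNIV. \<Sum>c\<in>UNIV. \<Sum>a\<in>UNIV. e $ c * v $ b * v $ a * T c b a)"
    by (rule sum.swap)
  also have "\<dots> = (\<Sum>b\<in>UNIV. \<Sum>a\<in>UNIV. \<Sum>c\<in>UNIV. e $ c * v $ b * v $ a * T c b a)"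
    by (rule sum.cong[OF refl]) (rule sum.swap)
  also have "\<dots> = v \<bullet> (hessian_deriv f x e *v v)"
    by (simp add: inner_vec_def[of v] matrix_vector_mult_def H sum_distrib_left sum_distrib_right mult_ac)
  finally show ?thesis .
qed

text \<open>If \<open>g2\<close> were positive, \<open>g1\<close> would be positive just to the right of its zero, and \<open>g\<close> would increase
  there.\<close>

lemma second_derivative_test_max:
  fixes g :: "real \<Rightarrow> real"
  assumes d: "d > 0" and g1: "\<And>t. \<bar>t\<bar> < d \<Longrightarrow> (g has_real_derivative g1 t) (at t)"
    and g2: "(g1 has_real_derivative g2) (at 0)"
    and max: "\<And>t. \<bar>t\<bar> < d \<Longrightarrow> g t \<le> g 0"
  shows "g1 0 = 0" "g2 \<le> 0"
proof -
  show g10: "g1 0 = 0"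
    using DERIV_local_max[OF g1[of 0] d] max d by simp
  show "g2 \<le> 0"
  proof (rule ccontr)
    assume "\<not> g2 \<le> 0"
    then obtain c where c: "c > 0" "\<And>h. 0 < h \<Longrightarrow> h < c \<Longrightarrow> g1 0 < g1 (0 + h)"
      using DERIV_pos_inc_right[OF g2] by auto
    define h where "h = min c d / 2"
    have h: "0 < h" "h < c" "h < d" using c(1) d by (auto simp: h_def)
    obtain s where s: "0 < s" "s < h" "g h - g 0 = (h - 0) * g1 s"
      using MVT2[OF h(1), of g g1] g1 h by auto
    then have "g h > g 0"
      using c(2)[of s] h g10 by (simp add: algebra_simps)
    then show False using max[of h] h by simp
  qed
qed

section \<open>Small slope near a lower bound\<close>

lemma quadratic_form_eigenbasis:
  fixes v :: "'n \<Rightarrow> real ^ 'n"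
  assumes sym: "transpose A = A" and v: "orthonormal v" and l: "\<And>i. A *v v i = l i *\<^sub>R v i"
  shows "x \<bullet> (A *v x) = (\<Sum>k\<in>UNIV. l k * (x \<bullet> v k)\<^sup>2)"
proof -
  have "x \<bullet> (A *v x) = (\<Sum>k\<in>UNIV. (x \<bullet> v k) * ((A *v x) \<bullet> v k))"
    by (rule orthonormal_expansion[OF v, symmetric])
  also have "\<dots> = (\<Sum>k\<in>UNIV. l k * (x \<bullet> v k)\<^sup>2)"
  proof (rule sum.cong[OF refl])
    fix k
    have "(A *v x) \<bullet> v k = l k * (x \<bullet> v k)"
      using inner_symmetric_matrix[OF sym, of "v k" x] by (simp add: l inner_commute)
    then show "(x \<bullet> v k) * ((A *v x) \<bullet> v k) = l k * (x \<bullet> v k)\<^sup>2"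
      by (simp add: power2_eq_square)
  qed
  finally show ?thesis .
qed

lemma quadratic_form_le:
  fixes A :: "real ^ 'n ^ 'n"
  assumes sym: "transpose A = A" and K: "\<And>l. l \<in># eigenvalues A \<Longrightarrow> \<bar>l\<bar> \<le> K"
  shows "x \<bullet> (A *v x) \<le> K * (x \<bullet> x)" "0 \<le> K"
proof -
  obtain v :: "'n \<Rightarrow> real ^ 'n" and l where v: "orthonormal v" and l: "\<And>i. A *v v i = l i *\<^sub>R v i"
    using symmetric_orthonormal_eigenbasis[OF sym] by blast
  have lK: "\<bar>l k\<bar> \<le> K" for k
    by (rule K) (simp add: eigenvalues_eigenbasis[OF v l])
  then show "0 \<le> K" using abs_ge_zero order_trans by blast
  have "x \<bullet> (A *v x) \<le> (\<Sum>k\<in>UNIV. K * ((x \<bullet> v k) * (x \<bullet> v k)))"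
    unfolding quadratic_form_eigenbasis[OF sym v l] power2_eq_square
    by (intro sum_mono mult_right_mono) (use lK in \<open>auto simp: abs_le_iff\<close>)
  then show "x \<bullet> (A *v x) \<le> K * (x \<bullet> x)"
    by (simp add: sum_distrib_left[symmetric] orthonormal_expansion[OF v])
qed

text \<open>The gap \<open>d\<close> between \<open>f x\<close> and the lower bound \<open>c\<close> controls the slope like \<open>sqrt d\<close>: by Taylor's
  formula a step \<open>t\<close> along the segment keeps \<open>f - c\<close> nonnegative only if the slope is at least
  \<open>- d / t - K t / 2\<close>, which is of order \<open>- t\<close> as long as \<open>d\<close> is at most of order \<open>t\<^sup>2\<close>.\<close>

lemma directional_derivative_lower_bound:
  assumes f: "C_k_on 2 f S" "open S" and seg: "\<And>s. 0 \<le> s \<Longrightarrow> s \<le> t \<Longrightarrow> x + s *\<^sub>R e \<in> S"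
    and K: "\<And>y l. y \<in> S \<Longrightarrow> l \<in># eigenvalues (hessian f y) \<Longrightarrow> \<bar>l\<bar> \<le> K"
    and low: "\<And>y. y \<in> S \<Longrightarrow> c \<le> f y" and t: "0 < t" and e: "norm e = 1"
    and gap: "f x - c \<le> 16 * t\<^sup>2"
  shows "- ((16 + K / 2) * t) \<le> grad f x \<bullet> e"
proof -
  define D where "D m = (case m of 0 \<Rightarrow> \<lambda>s. f (x + s *\<^sub>R e)
    | Suc 0 \<Rightarrow> \<lambda>s. grad f (x + s *\<^sub>R e) \<bullet> e
    | _ \<Rightarrow> \<lambda>s. e \<bullet> (hessian f (x + s *\<^sub>R e) *v e))" for m :: nat
  have "\<exists>s. 0 < s \<and> s < t \<and> f (x + t *\<^sub>R e)
      = (\<Sum>m<2. (D m 0 / fact m) * (t - 0) ^ m) + (D 2 s / fact 2) * (t - 0)\<^sup>2"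
  proof (rule Taylor_up)
    show "\<forall>m s. m < 2 \<and> 0 \<le> s \<and> s \<le> t \<longrightarrow> (D m has_real_derivative D (Suc m) s) (at s)"
    proof safe
      fix m :: nat and s assume ms: "m < 2" "0 \<le> s" "s \<le> t"
      have xs: "x + s *\<^sub>R e \<in> S" using seg ms by simp
      consider "m = 0" | "m = 1" using ms by linarith
      then show "(D m has_real_derivative D (Suc m) s) (at s)"
      proof cases
        case 1
        have "f differentiable (at (x + s *\<^sub>R e))"
          using C_k_on_differentiable[OF f xs, of "[]"] by simp
        from DERIV_along_line[OF this] show ?thesis by (simp add: D_def 1)
      next
        case 2
        show ?thesis using DERIV_grad_along_line[OF f xs, of e] by (simp add: D_def 2)
      qed
    qed
  qed (use t in \<open>auto simp: D_def\<close>)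
  then obtain s where s: "0 < s" "s < t" and
    taylor: "f (x + t *\<^sub>R e) = f x + (grad f x \<bullet> e) * t + (e \<bullet> (hessian f (x + s *\<^sub>R e) *v e)) / 2 * t\<^sup>2"
    by (auto simp: D_def eval_nat_numeral)
  have xs: "x + s *\<^sub>R e \<in> S" and xt: "x + t *\<^sub>R e \<in> S" using seg s t by auto
  have "e \<bullet> (hessian f (x + s *\<^sub>R e) *v e) \<le> K * (e \<bullet> e)"
    by (rule quadratic_form_le(1)[OF transpose_hessian[OF f xs]]) (use K[OF xs] in blast)
  also have "e \<bullet> e = 1" using e by (simp add: dot_square_norm)
  finally have "(e \<bullet> (hessian f (x + s *\<^sub>R e) *v e)) / 2 * t\<^sup>2 \<le> K / 2 * t\<^sup>2"
    by (intro mult_right_mono) auto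
  with taylor low[OF xt] gap have "0 \<le> 16 * t\<^sup>2 + (grad f x \<bullet> e) * t + K / 2 * t\<^sup>2"
    by linarith
  also have "\<dots> = t * (16 * t + grad f x \<bullet> e + K / 2 * t)"
    by (simp add: algebra_simps power2_eq_square)
  finally have "0 \<le> 16 * t + grad f x \<bullet> e + K / 2 * t"
    using t by (simp add: zero_le_mult_iff)
  then show ?thesis by (simp add: algebra_simps)
qed

section \<open>Inequalities at an interior maximum\<close>

text \<open>All values of \<open>arctan\<close> lie below \<open>\<pi>/2\<close>. With the entry \<open>-r\<close> contributing \<open>- arctan r\<close>, the sum can
  reach the lower bound only if every other entry makes up for it on its own, the remaining
  \<open>n - 2\<close> entries contributing at most \<open>\<pi>/2\<close> each. Even with all other entries at \<open>\<pi>/2\<close> the sum exceeds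
  the lower bound only by \<open>\<pi>/2 - arctan r = arctan (1 / r)\<close>.\<close>

lemma arctan_sum_negative_entry:
  fixes l :: "'n::finite \<Rightarrow> real"
  assumes low: "(real CARD('n) - 2) * (pi / 2) \<le> (\<Sum>j\<in>UNIV. arctan (l j))"
    and k: "l k = - r" "r > 0"
  shows "j \<noteq> k \<Longrightarrow> r \<le> l j"
    and "(\<Sum>j\<in>UNIV. arctan (l j)) - (real CARD('n) - 2) * (pi / 2) \<le> 1 / r"
proof -
  have half: "arctan (l j) \<le> pi / 2" for j using arctan_ubound[of "l j"] by simp
  have c1: "real (card (UNIV - {k} :: 'n set)) = real CARD('n) - 1"
    by (simp add: card_Diff_singleton of_nat_diff Suc_leI)
  have S: "(\<Sum>j\<in>UNIV. arctan (l j)) = - arctan r + (\<Sum>j\<in>UNIV - {k}. arctan (l j))"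
    by (subst sum.remove[of _ k]) (auto simp: k arctan_minus)
  have "(\<Sum>j\<in>UNIV - {k}. arctan (l j)) \<le> (\<Sum>j\<in>UNIV - {k}. pi / 2)"
    by (intro sum_mono half)
  also have "\<dots> = (real CARD('n) - 1) * (pi / 2)" by (simp only: sum_constant c1)
  finally have "(\<Sum>j\<in>UNIV. arctan (l j)) - (real CARD('n) - 2) * (pi / 2) \<le> pi / 2 - arctan r"
    using S by (simp add: algebra_simps)
  also have "\<dots> = arctan (1 / r)"
    using arctan_inverse[of r] k(2) by (simp add: sgn_if inverse_eq_divide)
  also have "\<dots> \<le> 1 / r"
    using arctan_le_self[of "1 / r"] k(2) by simp
  finally show "(\<Sum>j\<in>UNIV. arctan (l j)) - (real CARD('n) - 2) * (pi / 2) \<le> 1 / r" .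
  assume j: "j \<noteq> k"
  have c2: "real (card (UNIV - {k} - {j} :: 'n set)) = real CARD('n) - 2"
  proof -
    have "card {k, j} \<le> CARD('n)" by (intro card_mono) auto
    then have "2 \<le> CARD('n)" using j by simp
    then show ?thesis using j by (simp add: card_Diff_singleton of_nat_diff)
  qed
  have "(\<Sum>j\<in>UNIV - {k}. arctan (l j)) = arctan (l j) + (\<Sum>j\<in>UNIV - {k} - {j}. arctan (l j))"
    using j by (subst sum.remove[of _ j]) auto
  also have "(\<Sum>j\<in>UNIV - {k} - {j}. arctan (l j)) \<le> (\<Sum>j\<in>UNIV - {k} - {j}. pi / 2)"
    by (intro sum_mono half)
  also have "\<dots> = (real CARD('n) - 2) * (pi / 2)" by (simp only: sum_constant c2)
  finally have "arctan r \<le> arctan (l j)" using S low by simp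
  then show "r \<le> l j" by (simp add: arctan_le_iff)
qed

text \<open>Dividing the first order condition by \<open>\<epsilon>\<close> expresses \<open>- \<eta> l\<close> as \<open>2 n (w / L) p\<close>, which lies between
  \<open>2 n p\<close> and \<open>4 n p\<close>, plus \<open>b p / \<epsilon>\<close>, which is at most \<open>n p\<close> in absolute value. The weight \<open>n / L\<close> in the
  test function is chosen for the first to dominate the second.\<close>

lemma large_negative_eigenvalue:
  fixes n L w p \<eta> b l \<epsilon> :: real
  assumes n: "n \<ge> 1" and L: "L > 0" "L \<le> w" "w \<le> 2 * L" and p: "p > 0"
    and b: "\<bar>b\<bar> \<le> 1" and \<epsilon>: "1 \<le> n * \<epsilon>\<^sup>2"
    and first: "b * p + \<eta> * l * \<epsilon> + 2 * (n / L) * w * p * \<epsilon> = 0"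
  shows "n * p \<le> \<eta> * (- l)" "\<eta> * (- l) \<le> 5 * n * p"
proof -
  have nz: "\<epsilon> \<noteq> 0" using \<epsilon> by auto
  have "(1::real)\<^sup>2 \<le> (n * \<bar>\<epsilon>\<bar>)\<^sup>2"
  proof -
    have "n * \<epsilon>\<^sup>2 \<le> n * (n * \<epsilon>\<^sup>2)" using mult_right_mono[OF n, of "n * \<epsilon>\<^sup>2"] \<epsilon> by simp
    then show ?thesis using \<epsilon> by (simp add: power2_eq_square mult_ac)
  qed
  then have "1 \<le> n * \<bar>\<epsilon>\<bar>" using n by (intro power2_le_imp_le[of 1]) auto
  then have "\<bar>b / \<epsilon>\<bar> \<le> n" using b nz by (simp add: abs_divide divide_simps)
  then have be: "\<bar>b / \<epsilon> * p\<bar> \<le> n * p"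
    unfolding abs_mult using p n by (intro mult_mono) auto
  have eq: "\<eta> * (- l) = 2 * (n * p * (w / L)) + b / \<epsilon> * p"
    using first nz L(1) by (simp add: field_simps)
  have "n * p * 1 \<le> n * p * (w / L)" "n * p * (w / L) \<le> n * p * 2"
    using n p L by (intro mult_left_mono; simp add: field_simps)+
  then have "2 * (n * p) \<le> 2 * (n * p * (w / L)) \<and> 2 * (n * p * (w / L)) \<le> 4 * (n * p)"
    by linarith
  moreover have "- (n * p) \<le> b / \<epsilon> * p \<and> b / \<epsilon> * p \<le> n * p"
    using be unfolding abs_le_iff by linarith
  ultimately have "n * p \<le> \<eta> * (- l) \<and> \<eta> * (- l) \<le> 5 * (n * p)"
    unfolding eq by linarith
  then show "n * p \<le> \<eta> * (- l)" "\<eta> * (- l) \<le> 5 * n * p"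
    by (simp_all only: mult.assoc)
qed

text \<open>The sum of the second order conditions with weights \<open>F j = 1 / (1 + l\<^sub>j\<^sup>2)\<close>, for eigenvalues that
  are all at least \<open>r\<close> in absolute value, so that \<open>F j \<le> 1 / r\<^sup>2\<close> and \<open>F j |l\<^sub>j| \<le> 1 / r\<close>. The
  gradient term is kept only in direction \<open>k\<close>, where the weight is as large as possible and \<open>\<epsilon>\<close> is
  bounded below. In the sum of the \<open>F j l\<^sub>j\<close> all terms but the one of \<open>k\<close> are nonnegative.\<close>

lemma weighted_second_order_inequality:
  fixes l b \<epsilon> T :: "'n::finite \<Rightarrow> real" and w p \<eta> A r :: real
  defines "n \<equiv> real CARD('n)"
  assumes p: "p > 0" and A: "A > 0" and w: "w > 0" and \<eta>: "\<eta> > 0"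
    and r: "r \<ge> 1" and lk: "l k = - r" and lj: "\<And>j. j \<noteq> k \<Longrightarrow> r \<le> l j"
    and b: "\<And>j. \<bar>b j\<bar> \<le> 1" and \<epsilon>: "\<And>j. \<bar>\<epsilon> j\<bar> \<le> 1" and \<epsilon>k: "1 \<le> n * (\<epsilon> k)\<^sup>2"
    and second: "\<And>j. - 2 * p + 2 * b j * l j * \<epsilon> j + \<eta> * T j
        + 2 * A * (p\<^sup>2 * (\<epsilon> j)\<^sup>2 + w * l j) \<le> 0"
    and T: "- d \<le> (\<Sum>j\<in>UNIV. T j / (1 + (l j)\<^sup>2))"
  shows "A * p\<^sup>2 / (n * r\<^sup>2) \<le> 2 * n * p / r\<^sup>2 + 2 * n / r + 2 * A * w / r + \<eta> * d"
proof -
  define F where "F j = 1 / (1 + (l j)\<^sup>2)" for j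
  have r0: "r > 0" using r by simp
  have rl: "r \<le> \<bar>l j\<bar>" for j using lj[of j] lk r by (cases "j = k") auto
  have den: "1 + (l j)\<^sup>2 > 0" for j by (simp add: add_pos_nonneg)
  have F0: "F j > 0" for j using den by (simp add: F_def)
  have F1: "F j \<le> 1 / r\<^sup>2" for j
  proof -
    have "r\<^sup>2 \<le> 1 + (l j)\<^sup>2" using rl[of j] r0 power_mono[of r "\<bar>l j\<bar>" 2] by simp
    then show ?thesis using r0 by (simp add: F_def frac_le)
  qed
  have F2: "F j * \<bar>l j\<bar> \<le> 1 / r" for j
  proof -
    have "r * \<bar>l j\<bar> \<le> \<bar>l j\<bar> * \<bar>l j\<bar>" using rl[of j] by (intro mult_right_mono) auto
    then have "r * \<bar>l j\<bar> \<le> 1 + (l j)\<^sup>2" by (simp add: power2_eq_square)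
    then show ?thesis using r0 den[of j] by (simp add: F_def field_simps)
  qed
  have "0 \<ge> (\<Sum>j\<in>UNIV. F j * (- 2 * p + 2 * b j * l j * \<epsilon> j + \<eta> * T j
        + 2 * A * (p\<^sup>2 * (\<epsilon> j)\<^sup>2 + w * l j)))"
    by (intro sum_nonpos mult_nonneg_nonpos second less_imp_le[OF F0])
  also have "(\<Sum>j\<in>UNIV. F j * (- 2 * p + 2 * b j * l j * \<epsilon> j + \<eta> * T j
        + 2 * A * (p\<^sup>2 * (\<epsilon> j)\<^sup>2 + w * l j)))
      = (\<Sum>j\<in>UNIV. - 2 * p * F j) + (\<Sum>j\<in>UNIV. 2 * b j * \<epsilon> j * (F j * l j)) + \<eta> * (\<Sum>j\<in>UNIV. T j * F j)
        + 2 * A * p\<^sup>2 * (\<Sum>j\<in>UNIV. F j * (\<epsilon> j)\<^sup>2) + 2 * A * w * (\<Sum>j\<in>UNIV. F j * l j)"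
    unfolding sum_distrib_left sum.distrib[symmetric]
    by (intro sum.cong refl) (simp add: algebra_simps)
  finally have main: "(\<Sum>j\<in>UNIV. - 2 * p * F j) + (\<Sum>j\<in>UNIV. 2 * b j * \<epsilon> j * (F j * l j)) + \<eta> * (\<Sum>j\<in>UNIV. T j * F j)
        + 2 * A * p\<^sup>2 * (\<Sum>j\<in>UNIV. F j * (\<epsilon> j)\<^sup>2) + 2 * A * w * (\<Sum>j\<in>UNIV. F j * l j) \<le> 0" .
  have t1: "- (2 * n * p / r\<^sup>2) \<le> (\<Sum>j\<in>UNIV. - 2 * p * F j)"
  proof -
    have "(\<Sum>j\<in>(UNIV :: 'n set). - 2 * p * (1 / r\<^sup>2)) \<le> (\<Sum>j\<in>UNIV. - 2 * p * F j)"
      using F1 p by (intro sum_mono mult_left_mono_neg) auto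
    then show ?thesis by (simp add: n_def mult_ac)
  qed
  have t2: "- (2 * n / r) \<le> (\<Sum>j\<in>UNIV. 2 * b j * \<epsilon> j * (F j * l j))"
  proof -
    have "- (2 * (1 / r)) \<le> 2 * b j * \<epsilon> j * (F j * l j)" for j
    proof -
      have "\<bar>b j * \<epsilon> j * (F j * l j)\<bar> = \<bar>b j\<bar> * \<bar>\<epsilon> j\<bar> * (F j * \<bar>l j\<bar>)"
        using F0[of j] by (simp add: abs_mult)
      also have "\<dots> \<le> 1 * 1 * (1 / r)"
        using b[of j] \<epsilon>[of j] F2[of j] F0[of j] by (intro mult_mono) auto
      finally show ?thesis by (simp add: abs_le_iff)
    qed
    then have "(\<Sum>j\<in>(UNIV :: 'n set). - (2 * (1 / r))) \<le> (\<Sum>j\<in>UNIV. 2 * b j * \<epsilon> j * (F j * l j))"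
      by (intro sum_mono)
    then show ?thesis by (simp add: n_def mult_ac)
  qed
  have t3: "\<eta> * (- d) \<le> \<eta> * (\<Sum>j\<in>UNIV. T j * F j)"
    using T \<eta> by (intro mult_left_mono) (auto simp: F_def)
  have t4: "2 * A * p\<^sup>2 * (1 / (2 * n * r\<^sup>2)) \<le> 2 * A * p\<^sup>2 * (\<Sum>j\<in>UNIV. F j * (\<epsilon> j)\<^sup>2)"
  proof (rule mult_left_mono)
    have n0: "n > 0" by (simp add: n_def)
    have "1 + r\<^sup>2 \<le> 2 * r\<^sup>2" using r power_mono[of 1 r 2] by simp
    then have "1 / (2 * r\<^sup>2) \<le> F k" using r0 by (simp add: F_def lk frac_le add_pos_nonneg)
    moreover have "1 / n \<le> (\<epsilon> k)\<^sup>2" using \<epsilon>k n0 by (simp add: field_simps)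
    ultimately have "1 / (2 * r\<^sup>2) * (1 / n) \<le> F k * (\<epsilon> k)\<^sup>2"
      using n0 F0[of k] by (intro mult_mono) auto
    also have "\<dots> \<le> (\<Sum>j\<in>UNIV. F j * (\<epsilon> j)\<^sup>2)"
      by (intro member_le_sum mult_nonneg_nonneg less_imp_le[OF F0]) auto
    finally show "1 / (2 * n * r\<^sup>2) \<le> (\<Sum>j\<in>UNIV. F j * (\<epsilon> j)\<^sup>2)" by (simp add: mult_ac)
  qed (use A in auto)
  have t5: "2 * A * w * (- (1 / r)) \<le> 2 * A * w * (\<Sum>j\<in>UNIV. F j * l j)"
  proof (rule mult_left_mono)
    have "- (1 / r) \<le> F k * l k" using F2[of k] lk r0 by simp
    moreover have "0 \<le> (\<Sum>j\<in>UNIV - {k}. F j * l j)"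
    proof (intro sum_nonneg)
      fix j assume "j \<in> UNIV - {k}"
      then have "0 \<le> l j" using lj[of j] r0 by auto
      then show "0 \<le> F j * l j" using F0[of j] by simp
    qed
    ultimately show "- (1 / r) \<le> (\<Sum>j\<in>UNIV. F j * l j)"
      by (subst sum.remove[of _ k]) auto
  qed (use A w in auto)
  have "2 * A * p\<^sup>2 * (1 / (2 * n * r\<^sup>2)) = A * p\<^sup>2 / (n * r\<^sup>2)" by simp
  with main t1 t2 t3 t4 t5 show ?thesis by simp
qed

text \<open>With \<open>s = sqrt (\<eta> p)\<close> and \<open>r\<close> comparable to \<open>p / \<eta>\<close>, the left side of the last hypothesis is at least
  \<open>\<eta>\<^sup>2 / (25 n\<^sup>2 L)\<close>, and each term on its right side is at most \<open>\<eta>\<^sup>2 / s\<close> times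
  a constant or, in the last one, \<open>4 + K / 8\<close>, since \<open>\<eta> \<le> 1\<close> and \<open>s \<ge> 1\<close>.\<close>

lemma weighted_gradient_bound:
  fixes n L p \<eta> r K :: real
  assumes n: "n \<ge> 1" and L: "L > 0" and p: "p > 0" and \<eta>: "0 < \<eta>" "\<eta> \<le> 1" and K: "K \<ge> 0"
    and q: "\<eta> * p \<ge> 1"
    and r: "n * p \<le> \<eta> * r" "\<eta> * r \<le> 5 * n * p"
    and ineq: "p\<^sup>2 / (L * r\<^sup>2) \<le> 2 * n * p / r\<^sup>2 + 6 * n / r + \<eta> * ((16 + K / 2) * (1 / (4 * sqrt r)))"
  shows "sqrt (\<eta> * p) \<le> 25 * n\<^sup>2 * (12 + K / 8) * L"
proof -
  define s where "s = sqrt (\<eta> * p)"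
  have q0: "\<eta> * p > 0" using p \<eta> by simp
  have s1: "s \<ge> 1" using q by (simp add: s_def)
  then have s0: "s > 0" by simp
  have s2: "s\<^sup>2 = \<eta> * p" using q0 by (simp add: s_def)
  have r0: "r > 0"
  proof -
    have "\<eta> * r > 0" using r(1) n p by (smt (verit) mult_pos_pos)
    then show ?thesis using \<eta> by (simp add: zero_less_mult_iff)
  qed
  have inv: "1 / r \<le> \<eta> / (n * p)" using r(1) r0 n p by (simp add: field_simps)
  have inv': "\<eta> / (5 * n * p) \<le> 1 / r" using r(2) r0 n p by (simp add: field_simps)
  have sinv: "1 / s\<^sup>2 \<le> 1 / s" using s1 by (simp add: power2_eq_square field_simps)
  have a: "\<eta>\<^sup>2 / (25 * n\<^sup>2 * L) \<le> p\<^sup>2 / (L * r\<^sup>2)"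
  proof -
    have "(\<eta> / (5 * n * p))\<^sup>2 \<le> (1 / r)\<^sup>2"
      using inv' n p \<eta> by (intro power_mono) auto
    then have "(p\<^sup>2 / L) * (\<eta> / (5 * n * p))\<^sup>2 \<le> (p\<^sup>2 / L) * (1 / r)\<^sup>2"
      using L by (intro mult_left_mono) auto
    then show ?thesis using p by (simp add: power_mult_distrib power_divide mult_ac)
  qed
  have ninv: "\<eta> / (n * p) \<le> \<eta> / p"
    using n p \<eta> by (intro divide_left_mono) (auto simp: mult_le_cancel_right1)
  have ep: "\<eta> / p = \<eta>\<^sup>2 / s\<^sup>2" using s2 \<eta> p by (simp add: power2_eq_square)
  have b1: "2 * n * p / r\<^sup>2 \<le> 2 * \<eta>\<^sup>2 / s"
  proof -
    have "(1 / r)\<^sup>2 \<le> (\<eta> / (n * p))\<^sup>2"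
      using inv r0 by (intro power_mono) auto
    then have "(2 * n * p) * (1 / r)\<^sup>2 \<le> (2 * n * p) * (\<eta> / (n * p))\<^sup>2"
      using n p by (intro mult_left_mono) auto
    also have "\<dots> = 2 * \<eta> * (\<eta> / (n * p))"
      using n p by (simp add: power2_eq_square)
    also have "\<dots> \<le> 2 * \<eta> * (\<eta>\<^sup>2 / s\<^sup>2)"
      using ninv ep \<eta> by (intro mult_left_mono) auto
    also have "\<dots> \<le> 2 * 1 * (\<eta>\<^sup>2 * (1 / s))"
      using sinv \<eta> s0 by (intro mult_mono) (auto simp: divide_inverse intro!: mult_left_mono)
    finally show ?thesis by (simp add: power_divide)
  qed
  have b2: "6 * n / r \<le> 6 * \<eta>\<^sup>2 / s"
  proof -
    have "6 * n * (1 / r) \<le> 6 * n * (\<eta> / (n * p))"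
      using inv n by (intro mult_left_mono) auto
    also have "\<dots> = 6 * (\<eta>\<^sup>2 * (1 / s\<^sup>2))" using n ep by simp
    also have "\<dots> \<le> 6 * (\<eta>\<^sup>2 * (1 / s))"
      using sinv by (intro mult_left_mono) auto
    finally show ?thesis by simp
  qed
  have b3: "1 / sqrt r \<le> \<eta> / s"
  proof -
    have "1 / r \<le> \<eta> / p" using inv ninv by simp
    then have "sqrt (1 / r) \<le> sqrt ((\<eta> / s)\<^sup>2)"
      unfolding ep by (simp add: power_divide)
    then show ?thesis using \<eta> s0 by (simp add: real_sqrt_divide)
  qed
  have "\<eta> * ((16 + K / 2) * (1 / (4 * sqrt r))) = \<eta> * (4 + K / 8) * (1 / sqrt r)"
    by (simp add: field_simps)
  also have "\<dots> \<le> \<eta> * (4 + K / 8) * (\<eta> / s)"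
    using b3 K \<eta> by (intro mult_left_mono) auto
  also have "\<dots> = (4 + K / 8) * \<eta>\<^sup>2 / s" by (simp add: power2_eq_square)
  finally have "\<eta>\<^sup>2 / (25 * n\<^sup>2 * L) \<le> 2 * \<eta>\<^sup>2 / s + 6 * \<eta>\<^sup>2 / s + (4 + K / 8) * \<eta>\<^sup>2 / s"
    using a b1 b2 ineq by linarith
  also have "\<dots> = \<eta>\<^sup>2 * ((12 + K / 8) / s)" using s0 by (simp add: field_simps)
  finally have "\<eta>\<^sup>2 * (1 / (25 * n\<^sup>2 * L)) \<le> \<eta>\<^sup>2 * ((12 + K / 8) / s)" by simp
  then have "1 / (25 * n\<^sup>2 * L) \<le> (12 + K / 8) / s"
    using \<eta>(1) by (simp only: mult_le_cancel_left_pos zero_less_power)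
  then have "s \<le> 25 * n\<^sup>2 * (12 + K / 8) * L"
    using s0 L n by (simp add: field_simps)
  then show ?thesis by (simp add: s_def)
qed

section \<open>The maximum principle\<close>

text \<open>Here \<open>\<eta>\<close> and \<open>b\<close> are the value of the cutoff and its derivative in direction \<open>v\<close>; its second
  derivative in direction \<open>v\<close> is \<open>- 2\<close>.\<close>

lemma interior_max_directional_conditions:
  fixes u :: "real ^ 'n \<Rightarrow> real"
  assumes u: "C_k_on 3 u (ball 0 1)" and x0: "norm x0 < 1 / 2" and v: "norm v = 1"
    and max: "\<And>x. norm x < 1 / 2 \<Longrightarrow>
      (1 / 4 - x \<bullet> x) * (grad u x \<bullet> e) + A * (u x - c)\<^sup>2
      \<le> (1 / 4 - x0 \<bullet> x0) * (grad u x0 \<bullet> e) + A * (u x0 - c)\<^sup>2"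
  defines "\<eta> \<equiv> 1 / 4 - x0 \<bullet> x0" and "b \<equiv> - 2 * (x0 \<bullet> v)"
  shows "b * (grad u x0 \<bullet> e) + \<eta> * (e \<bullet> (hessian u x0 *v v))
      + 2 * A * (u x0 - c) * (grad u x0 \<bullet> v) = 0" (is ?first)
    and "- 2 * (grad u x0 \<bullet> e) + 2 * b * (e \<bullet> (hessian u x0 *v v))
      + \<eta> * (e \<bullet> (hessian_deriv u x0 v *v v))
      + 2 * A * ((grad u x0 \<bullet> v)\<^sup>2 + (u x0 - c) * (v \<bullet> (hessian u x0 *v v))) \<le> 0" (is ?second)
proof -
  let ?x = "\<lambda>t. x0 + t *\<^sub>R v"
  define d where "d = 1 / 2 - norm x0"
  have d: "d > 0" using x0 by (simp add: d_def)
  have near: "norm (?x t) < 1 / 2" if "\<bar>t\<bar> < d" for t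
    using norm_triangle_ineq[of x0 "t *\<^sub>R v"] v that by (simp add: d_def)
  have inball: "?x t \<in> ball 0 1" if "\<bar>t\<bar> < d" for t
    using near[OF that] by simp
  have u2: "C_k_on 2 u (ball 0 1)" using C_k_on_mono[OF u] by simp
  define g where "g t = (1 / 4 - ?x t \<bullet> ?x t) * (grad u (?x t) \<bullet> e) + A * (u (?x t) - c)\<^sup>2" for t
  define g1 where "g1 t = - 2 * (?x t \<bullet> v) * (grad u (?x t) \<bullet> e)
    + (1 / 4 - ?x t \<bullet> ?x t) * (e \<bullet> (hessian u (?x t) *v v))
    + 2 * A * ((u (?x t) - c) * (grad u (?x t) \<bullet> v))" for t
  define g2 where "g2 = - 2 * (grad u x0 \<bullet> e) + 2 * b * (e \<bullet> (hessian u x0 *v v))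
      + \<eta> * (e \<bullet> (hessian_deriv u x0 v *v v))
      + 2 * A * ((grad u x0 \<bullet> v)\<^sup>2 + (u x0 - c) * (v \<bullet> (hessian u x0 *v v)))"
  have du: "((\<lambda>t. u (?x t)) has_real_derivative grad u (?x t) \<bullet> v) (at t)" if "\<bar>t\<bar> < d" for t
    using C_k_on_differentiable[OF u _ inball[OF that], of "[]"] by (intro DERIV_along_line) simp
  have dgrad: "((\<lambda>t. grad u (?x t) \<bullet> w) has_real_derivative w \<bullet> (hessian u (?x t) *v v)) (at t)"
    if "\<bar>t\<bar> < d" for t w
    using DERIV_grad_along_line[OF u2 _ inball[OF that]] by simp
  have dx: "((\<lambda>t. ?x t \<bullet> v) has_real_derivative 1) (at t)" for t
    using v by (auto intro!: derivative_eq_intros simp: inner_add_left dot_square_norm)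
  have dxx: "((\<lambda>t. 1 / 4 - ?x t \<bullet> ?x t) has_real_derivative - 2 * (?x t \<bullet> v)) (at t)" for t
    using v unfolding inner_add_left inner_add_right inner_scaleR_left inner_scaleR_right
    by (auto intro!: derivative_eq_intros simp: dot_square_norm inner_commute algebra_simps)
  have dhess: "((\<lambda>t. e \<bullet> (hessian u (?x t) *v v)) has_real_derivative
      e \<bullet> (hessian_deriv u x0 v *v v)) (at 0)"
  proof -
    have "((\<lambda>t. hessian u (?x t) $ i $ j) has_real_derivative hessian_deriv u x0 v $ i $ j) (at 0)" for i j
      using DERIV_hessian_along_line[OF u, of x0 0 v i j] inball[of 0] d by simp
    then show ?thesis
      unfolding inner_vec_def matrix_vector_mult_def
      by (auto intro!: derivative_eq_intros simp: mult.commute)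
  qed
  have G1: "(g has_real_derivative g1 t) (at t)" if "\<bar>t\<bar> < d" for t
    unfolding g_def g1_def
    by (rule derivative_eq_intros refl dxx dgrad[OF that] du[OF that] DERIV_const)+ (simp add: algebra_simps)
  have d0: "\<bar>0\<bar> < d" using d by simp
  have G2: "(g1 has_real_derivative g2) (at 0)"
  proof -
    have D: "((\<lambda>t. - 2 * (?x t \<bullet> v)) has_real_derivative - 2) (at 0)"
      using DERIV_cmult[OF dx[of 0], of "- 2"] by simp
    have P1: "((\<lambda>t. - 2 * (?x t \<bullet> v) * (grad u (?x t) \<bullet> e)) has_real_derivative
      - 2 * (grad u x0 \<bullet> e) + (e \<bullet> (hessian u x0 *v v)) * b) (at 0)"
      using DERIV_mult[OF D dgrad[OF d0, of e]] by (simp add: b_def)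
    have P2: "((\<lambda>t. (1 / 4 - ?x t \<bullet> ?x t) * (e \<bullet> (hessian u (?x t) *v v))) has_real_derivative
      b * (e \<bullet> (hessian u x0 *v v)) + (e \<bullet> (hessian_deriv u x0 v *v v)) * \<eta>) (at 0)"
      using DERIV_mult[OF dxx[of 0] dhess] by (simp add: b_def \<eta>_def)
    have P3: "((\<lambda>t. 2 * A * ((u (?x t) - c) * (grad u (?x t) \<bullet> v))) has_real_derivative
      2 * A * ((grad u x0 \<bullet> v) * (grad u x0 \<bullet> v) + (v \<bullet> (hessian u x0 *v v)) * (u x0 - c))) (at 0)"
      using DERIV_cmult[OF DERIV_mult[OF DERIV_diff[OF du[OF d0] DERIV_const[of c]] dgrad[OF d0, of v]], of "2 * A"]
      by simp
    from DERIV_add[OF DERIV_add[OF P1 P2] P3] show ?thesis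
      unfolding g1_def by (rule DERIV_cong) (simp add: g2_def power2_eq_square algebra_simps)
  qed
  have gmax: "g t \<le> g 0" if "\<bar>t\<bar> < d" for t
    using max[OF near[OF that]] by (simp add: g_def)
  have "g1 0 = 0" "g2 \<le> 0"
    using second_derivative_test_max[OF d G1 G2 gmax] by auto
  then show ?first ?second
    by (simp_all add: g1_def g2_def b_def \<eta>_def mult.assoc)
qed

lemma phase_equation_derivative:
  fixes u :: "real ^ 'n \<Rightarrow> real" and v :: "'n \<Rightarrow> real ^ 'n"
  assumes u: "C_k_on 3 u S" and \<psi>: "C_k_on 2 \<psi> S" and S: "open S" "x0 \<in> S"
    and eq: "\<And>x. x \<in> S \<Longrightarrow> (\<Sum>l\<in>#eigenvalues (hessian u x). arctan l) = \<psi> x"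
    and v: "orthonormal v" and l: "\<And>i. hessian u x0 *v v i = l i *\<^sub>R v i"
  shows "(\<Sum>k\<in>UNIV. (v k \<bullet> (hessian_deriv u x0 e *v v k)) / (1 + (l k)\<^sup>2)) = grad \<psi> x0 \<bullet> e"
proof (rule phase_derivative[where ?t0.0 = 0 and H = "\<lambda>t. hessian u (x0 + t *\<^sub>R e)" and \<phi> = "\<lambda>t. \<psi> (x0 + t *\<^sub>R e)"])
  have u2: "C_k_on 2 u S" using C_k_on_mono[OF u] by simp
  have "((\<lambda>t. x0 + t *\<^sub>R e) \<longlongrightarrow> x0 + 0 *\<^sub>R e) (nhds 0)"
    by (intro tendsto_intros filterlim_ident)
  then have "eventually (\<lambda>t. x0 + t *\<^sub>R e \<in> S) (nhds 0)"
    using S by (intro topological_tendstoD) auto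
  then show "eventually (\<lambda>t. transpose (hessian u (x0 + t *\<^sub>R e)) = hessian u (x0 + t *\<^sub>R e) \<and>
      (\<Sum>l\<in>#eigenvalues (hessian u (x0 + t *\<^sub>R e)). arctan l) = \<psi> (x0 + t *\<^sub>R e)) (nhds 0)"
    by eventually_elim (use transpose_hessian[OF u2 S(1)] eq in blast)
  show "((\<lambda>t. hessian u (x0 + t *\<^sub>R e) $ i $ j) has_real_derivative hessian_deriv u x0 e $ i $ j) (at 0)" for i j
    using DERIV_hessian_along_line[OF u S(1), of x0 0 e i j] S(2) by simp
  show "((\<lambda>t. \<psi> (x0 + t *\<^sub>R e)) has_real_derivative grad \<psi> x0 \<bullet> e) (at 0)"
    using DERIV_along_line[of \<psi> x0 0 e] C_k_on_differentiable[OF \<psi> S, of "[]"] by simp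
qed (use v l in auto)

text \<open>The conclusion of the maximum principle at an interior maximum point \<open>x0\<close>, for the test function
  in which \<open>|Du|\<close> is replaced by the derivative in the fixed direction \<open>e\<close> of \<open>Du(x0)\<close>.\<close>

lemma interior_max_estimate:
  fixes u \<psi> :: "real ^ 'n \<Rightarrow> real"
  defines "n \<equiv> real CARD('n)"
  assumes u: "C_k_on 3 u (ball 0 1)" and \<psi>: "C_k_on 2 \<psi> (ball 0 1)"
    and eq: "\<And>x. x \<in> ball 0 1 \<Longrightarrow> (\<Sum>l\<in>#eigenvalues (hessian u x). arctan l) = \<psi> x"
    and low: "\<And>x. x \<in> ball 0 1 \<Longrightarrow> (n - 2) * (pi / 2) \<le> \<psi> x"
    and K: "\<And>x l. x \<in> ball 0 1 \<Longrightarrow> l \<in># eigenvalues (hessian \<psi> x) \<Longrightarrow> \<bar>l\<bar> \<le> K"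
    and x0: "norm x0 < 1 / 2" and e: "norm e = 1" and grad: "grad u x0 = p *\<^sub>R e"
    and L: "L \<ge> 1" "L \<le> u x0 - c" "u x0 - c \<le> 2 * L"
    and big: "n * L \<le> (1 / 4 - x0 \<bullet> x0) * p"
    and max: "\<And>x. norm x < 1 / 2 \<Longrightarrow>
      (1 / 4 - x \<bullet> x) * (grad u x \<bullet> e) + n / L * (u x - c)\<^sup>2
      \<le> (1 / 4 - x0 \<bullet> x0) * p + n / L * (u x0 - c)\<^sup>2"
  shows "sqrt ((1 / 4 - x0 \<bullet> x0) * p) \<le> 25 * n\<^sup>2 * (12 + K / 8) * L"
proof -
  define \<eta> where "\<eta> = 1 / 4 - x0 \<bullet> x0"
  define w where "w = u x0 - c"
  have n1: "n \<ge> 1" by (simp add: n_def Suc_leI)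
  have x0S: "x0 \<in> ball 0 1" using x0 by simp
  have u2: "C_k_on 2 u (ball 0 1)" using C_k_on_mono[OF u] by simp
  have sym: "transpose (hessian u x0) = hessian u x0"
    using transpose_hessian[OF u2 _ x0S] by simp
  have ee: "e \<bullet> e = 1" using e by (simp add: dot_square_norm)
  have gp: "grad u x0 \<bullet> e = p" by (simp add: grad ee)
  have \<eta>: "0 < \<eta>" "\<eta> \<le> 1 / 4"
  proof -
    have "(norm x0)\<^sup>2 < (1 / 2)\<^sup>2" using x0 by (intro power_strict_mono) auto
    then show "0 < \<eta>" by (simp add: \<eta>_def dot_square_norm power2_eq_square)
  qed (simp add: \<eta>_def)
  have nL: "1 \<le> n * L" using n1 L(1) mult_mono[of 1 n 1 L] by simp
  have q: "1 \<le> \<eta> * p" using big nL by (simp add: \<eta>_def)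
  have p0: "p > 0" using q \<eta>(1) by (metis less_le_trans zero_less_one zero_less_mult_pos)
  obtain v :: "'n \<Rightarrow> real ^ 'n" and l where v: "orthonormal v" and l: "\<And>i. hessian u x0 *v v i = l i *\<^sub>R v i"
    using symmetric_orthonormal_eigenbasis[OF sym] by blast
  have normv: "norm (v j) = 1" for j
    using v by (simp add: orthonormal_def norm_eq_sqrt_inner)
  define \<epsilon> where "\<epsilon> j = e \<bullet> v j" for j
  define b where "b j = - 2 * (x0 \<bullet> v j)" for j
  have \<epsilon>1: "\<bar>\<epsilon> j\<bar> \<le> 1" for j
    using Cauchy_Schwarz_ineq2[of e "v j"] e normv by (simp add: \<epsilon>_def)
  have b1: "\<bar>b j\<bar> \<le> 1" for j
    using Cauchy_Schwarz_ineq2[of x0 "v j"] x0 normv[of j] by (simp add: b_def abs_mult)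
  have vv: "v j \<bullet> v j = 1" for j using v by (simp add: orthonormal_def)
  have first: "b j * p + \<eta> * l j * \<epsilon> j + 2 * (n / L) * w * p * \<epsilon> j = 0"
    and second: "- 2 * p + 2 * b j * l j * \<epsilon> j + \<eta> * (v j \<bullet> (hessian_deriv u x0 e *v v j))
      + 2 * (n / L) * (p\<^sup>2 * (\<epsilon> j)\<^sup>2 + w * l j) \<le> 0" for j
  proof -
    have max': "(1 / 4 - x \<bullet> x) * (grad u x \<bullet> e) + n / L * (u x - c)\<^sup>2
      \<le> (1 / 4 - x0 \<bullet> x0) * (grad u x0 \<bullet> e) + n / L * (u x0 - c)\<^sup>2" if "norm x < 1 / 2" for x
      using max[OF that] gp by simp
    have "e \<bullet> (hessian_deriv u x0 (v j) *v v j) = v j \<bullet> (hessian_deriv u x0 e *v v j)"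
      using hessian_deriv_symmetric[OF u _ x0S] by simp
    with interior_max_directional_conditions[OF u x0 normv max', of j]
    show "b j * p + \<eta> * l j * \<epsilon> j + 2 * (n / L) * w * p * \<epsilon> j = 0"
      "- 2 * p + 2 * b j * l j * \<epsilon> j + \<eta> * (v j \<bullet> (hessian_deriv u x0 e *v v j))
      + 2 * (n / L) * (p\<^sup>2 * (\<epsilon> j)\<^sup>2 + w * l j) \<le> 0"
      unfolding gp l by (simp_all add: grad ee vv \<epsilon>_def b_def \<eta>_def w_def power_mult_distrib mult_ac)
  qed
  \<comment> \<open>the \<open>n\<close> squared components of the unit vector \<open>e\<close> add up to one\<close>
  have "\<exists>k. 1 \<le> n * (\<epsilon> k)\<^sup>2"
  proof (rule ccontr)
    assume "\<nexists>k. 1 \<le> n * (\<epsilon> k)\<^sup>2"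
    then have "(\<Sum>k\<in>(UNIV :: 'n set). n * (\<epsilon> k)\<^sup>2) < (\<Sum>k\<in>(UNIV :: 'n set). 1)"
      by (intro sum_strict_mono) (auto simp: not_le)
    moreover have "(\<Sum>k\<in>UNIV. (\<epsilon> k)\<^sup>2) = 1"
      using orthonormal_expansion[OF v, of e e] ee by (simp add: \<epsilon>_def power2_eq_square)
    ultimately show False by (simp add: sum_distrib_left[symmetric] n_def)
  qed
  then obtain k where k: "1 \<le> n * (\<epsilon> k)\<^sup>2" ..
  define r where "r = - l k"
  have L0: "L > 0" using L(1) by simp
  have wL: "L \<le> w" "w \<le> 2 * L" using L by (auto simp: w_def)
  have r: "n * p \<le> \<eta> * r" "\<eta> * r \<le> 5 * n * p"
    unfolding r_def
    using large_negative_eigenvalue[OF n1 L0 wL p0 b1 k first] by auto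
  \<comment> \<open>large enough for the step \<open>t\<close> below to stay inside the unit ball, \<open>x0\<close> having norm below \<open>1/2\<close>\<close>
  have r16: "r \<ge> 16"
  proof -
    have "4 \<le> p"
    proof -
      have "\<eta> * p \<le> 1 / 4 * p" using \<eta>(2) p0 by (intro mult_right_mono) auto
      then show ?thesis using q by linarith
    qed
    then have "4 \<le> n * p" using n1 mult_mono[of 1 n 4 p] by simp
    then have "4 \<le> \<eta> * r" using r(1) by simp
    moreover have "r > 0" using \<open>4 \<le> \<eta> * r\<close> \<eta>(1) by (metis less_le_trans zero_less_numeral zero_less_mult_pos)
    ultimately have "4 \<le> \<eta> * r" "\<eta> * r \<le> 1 / 4 * r"
      using \<eta>(2) by (auto intro!: mult_right_mono)
    then show ?thesis by linarith
  qed
  have phase: "(\<Sum>j\<in>UNIV. arctan (l j)) = \<psi> x0"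
    using eq[OF x0S] by (simp add: eigenvalues_eigenbasis[OF v l] sum_unfold_sum_mset image_mset.compositionality o_def)
  have lowl: "(real CARD('n) - 2) * (pi / 2) \<le> (\<Sum>j\<in>UNIV. arctan (l j))"
    using low[OF x0S] by (simp add: phase n_def)
  have lk: "l k = - r" by (simp add: r_def)
  have r0: "r > 0" using r16 by simp
  have lj: "r \<le> l j" if "j \<noteq> k" for j
    using arctan_sum_negative_entry(1)[OF lowl lk r0 that] .
  have gap: "\<psi> x0 - (n - 2) * (pi / 2) \<le> 1 / r"
    using arctan_sum_negative_entry(2)[OF lowl lk r0] by (simp add: phase n_def)
  \<comment> \<open>the step with \<open>16 t\<^sup>2 = 1 / r\<close>, which bounds the gap between \<open>\<psi> x0\<close> and its lower bound\<close>
  define t where "t = 1 / (4 * sqrt r)"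
  have t: "0 < t" "t \<le> 1 / 2"
  proof -
    have "sqrt 16 \<le> sqrt r" using r16 by (rule real_sqrt_le_mono)
    then have "4 \<le> sqrt r" by simp
    then have "1 / (4 * sqrt r) \<le> 1 / (4 * 4)" using r0 by (intro divide_left_mono) auto
    then show "t \<le> 1 / 2" by (simp add: t_def)
    show "0 < t" using r0 by (simp add: t_def)
  qed
  have t2: "16 * t\<^sup>2 = 1 / r" using r0 by (simp add: t_def power_mult_distrib power_divide)
  have \<psi>e: "- ((16 + K / 2) * t) \<le> grad \<psi> x0 \<bullet> e"
  proof (rule directional_derivative_lower_bound[OF \<psi> _ _ K low t(1) e])
    show "x0 + s *\<^sub>R e \<in> ball 0 1" if "0 \<le> s" "s \<le> t" for s
      using norm_triangle_ineq[of x0 "s *\<^sub>R e"] that t(2) x0 e by simp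
  qed (use gap t2 in auto)
  have K0: "K \<ge> 0"
    by (rule quadratic_form_le(2)[OF transpose_hessian[OF \<psi> _ x0S]]) (use K[OF x0S] in auto)
  define A where "A = n / L"
  have A0: "A > 0" using n1 L0 by (simp add: A_def)
  have "A * p\<^sup>2 / (n * r\<^sup>2) \<le> 2 * n * p / r\<^sup>2 + 2 * n / r + 2 * A * w / r + \<eta> * ((16 + K / 2) * t)"
    unfolding n_def
  proof (rule weighted_second_order_inequality[where l = l and k = k and b = b and \<epsilon> = \<epsilon>
        and T = "\<lambda>j. v j \<bullet> (hessian_deriv u x0 e *v v j)"])
    show "- 2 * p + 2 * b j * l j * \<epsilon> j + \<eta> * (v j \<bullet> (hessian_deriv u x0 e *v v j))
      + 2 * A * (p\<^sup>2 * (\<epsilon> j)\<^sup>2 + w * l j) \<le> 0" for j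
      using second[of j] by (simp add: A_def)
    show "- ((16 + K / 2) * t) \<le> (\<Sum>j\<in>UNIV. (v j \<bullet> (hessian_deriv u x0 e *v v j)) / (1 + (l j)\<^sup>2))"
      using \<psi>e phase_equation_derivative[OF u \<psi> _ x0S eq v l, of e] by simp
  qed (use p0 A0 \<eta>(1) lk lj b1 \<epsilon>1 k wL L0 r16 in \<open>auto simp: n_def\<close>)
  moreover have "2 * A * w / r \<le> 4 * n / r"
  proof -
    have "A * w \<le> A * (2 * L)" using wL A0 by (intro mult_left_mono) auto
    also have "\<dots> = 2 * n" using L0 by (simp add: A_def)
    finally show ?thesis using r0 by (intro divide_right_mono) auto
  qed
  moreover have "A * p\<^sup>2 / (n * r\<^sup>2) = p\<^sup>2 / (L * r\<^sup>2)"
    using n1 by (simp add: A_def)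
  moreover have "2 * n / r + 4 * n / r = 6 * n / r" by (simp add: add_divide_distrib[symmetric])
  ultimately have "p\<^sup>2 / (L * r\<^sup>2) \<le> 2 * n * p / r\<^sup>2 + 6 * n / r + \<eta> * ((16 + K / 2) * (1 / (4 * sqrt r)))"
    by (simp add: t_def)
  moreover have "\<eta> \<le> 1" using \<eta>(2) by simp
  ultimately show ?thesis
    unfolding \<eta>_def[symmetric] by (intro weighted_gradient_bound[OF n1 L0 p0 \<eta>(1) _ K0 q r])
qed

section \<open>The gradient estimate\<close>

theorem theorem1p1:
  shows "\<exists>C :: real \<Rightarrow> real. \<forall>(u :: real ^ 'n \<Rightarrow> real) (\<psi> :: real ^ 'n \<Rightarrow> real).
    C_k_on_closure 3 u (ball 0 1) \<longrightarrow>
    C_k_on 2 \<psi> (ball 0 1) \<longrightarrow>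
    bdd_above (abs_hessian_eigenvalues (ball 0 1) \<psi>) \<longrightarrow>
    (\<forall>x\<in>ball 0 1. (\<Sum>l\<in>#eigenvalues (hessian u x). arctan l) = \<psi> x) \<longrightarrow>
    (\<forall>x\<in>ball 0 1. \<psi> x \<ge> (real CARD('n) - 2) * (pi / 2)) \<longrightarrow>
    norm (grad u 0) \<le> C (hessian_sup_norm (ball 0 1) \<psi>) * (1 + (osc (ball 0 1) u)\<^sup>2)"
proof -
  define n where "n = real CARD('n)"
  have n1: "n \<ge> 1" by (simp add: n_def Suc_leI)
  define M where "M K = 25 * n\<^sup>2 * (12 + K / 8)" for K
  show ?thesis
  proof (intro exI[of _ "\<lambda>K. 8 * (M K)\<^sup>2 + 32 * n"] allI impI)
    fix u \<psi> :: "real ^ 'n \<Rightarrow> real"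
    assume u: "C_k_on_closure 3 u (ball 0 1)" and \<psi>: "C_k_on 2 \<psi> (ball 0 1)"
      and bdd: "bdd_above (abs_hessian_eigenvalues (ball 0 1) \<psi>)"
      and eq: "\<forall>x\<in>ball 0 1. (\<Sum>l\<in>#eigenvalues (hessian u x). arctan l) = \<psi> x"
      and low: "\<forall>x\<in>ball 0 1. \<psi> x \<ge> (real CARD('n) - 2) * (pi / 2)"
    define K where "K = hessian_sup_norm (ball 0 1) \<psi>"
    have K: "\<bar>l\<bar> \<le> K" if "x \<in> ball 0 1" "l \<in># eigenvalues (hessian \<psi> x)" for x l
      unfolding K_def hessian_sup_norm_def
      using that by (intro cSup_upper[OF _ bdd]) (auto simp: abs_hessian_eigenvalues_def)
    have u3: "C_k_on 3 u (ball 0 1)" using u by (simp add: C_k_on_closure_def)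
    have "continuous_on (closure (ball 0 1)) u" using u by (simp add: C_k_on_closure_def)
    then have "compact (u ` closure (ball 0 1))"
      by (intro compact_continuous_image) (auto simp: compact_closure)
    then have "bounded (u ` ball 0 1)"
      by (meson bounded_subset closure_subset compact_imp_bounded image_mono)
    then have bdu: "bdd_above (u ` ball 0 1)" "bdd_below (u ` ball 0 1)"
      by (auto intro: bounded_imp_bdd_above bounded_imp_bdd_below)
    define m where "m = (INF x\<in>ball 0 1. u x)"
    define L where "L = 1 + osc (ball 0 1) u"
    define c where "c = m - L"
    have lo: "m \<le> u x" and hi: "u x \<le> m + osc (ball 0 1) u" if "x \<in> ball 0 1" for x
      using cINF_lower[OF bdu(2) that] cSUP_upper[OF that bdu(1)] by (auto simp: m_def osc_def)
    have osc0: "osc (ball 0 1) u \<ge> 0" using lo[of 0] hi[of 0] by simp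
    have L1: "L \<ge> 1" using osc0 by (simp add: L_def)
    have w: "L \<le> u x - c" "u x - c \<le> 2 * L" if "x \<in> ball 0 1" for x
      using lo[OF that] hi[OF that] by (auto simp: c_def L_def)
    have w2: "n * L \<le> n / L * (u x - c)\<^sup>2" "n / L * (u x - c)\<^sup>2 \<le> 4 * n * L" if "x \<in> ball 0 1" for x
    proof -
      have "L\<^sup>2 \<le> (u x - c)\<^sup>2" "(u x - c)\<^sup>2 \<le> (2 * L)\<^sup>2"
        using w[OF that] L1 by (intro power_mono; linarith)+
      then have "n / L * L\<^sup>2 \<le> n / L * (u x - c)\<^sup>2" "n / L * (u x - c)\<^sup>2 \<le> n / L * (2 * L)\<^sup>2"
        using n1 L1 by (intro mult_left_mono; simp)+
      then show "n * L \<le> n / L * (u x - c)\<^sup>2" "n / L * (u x - c)\<^sup>2 \<le> 4 * n * L"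
        using L1 by (auto simp: power2_eq_square)
    qed
    define W where "W x = (1 / 4 - x \<bullet> x) * norm (grad u x) + n / L * (u x - c)\<^sup>2" for x
    have sub: "cball 0 (1 / 2) \<subseteq> (ball 0 1 :: (real ^ 'n) set)" by auto
    have "continuous_on (ball 0 1) (iter_partial_deriv is u)" if "length is \<le> 3" for "is"
      using u3 that by (simp add: C_k_on_def)
    from this[of "[]"] this[of "[_]"]
    have cont: "continuous_on (ball 0 1) u" "\<And>i. continuous_on (ball 0 1) (partial_deriv i u)"
      by simp_all
    have "continuous_on (cball 0 (1 / 2)) W"
      unfolding W_def grad_def
      by (intro continuous_intros continuous_on_vec_lambda continuous_on_subset[OF cont(1) sub]
          continuous_on_subset[OF cont(2) sub])
    then have "\<exists>x\<in>cball 0 (1 / 2). \<forall>y\<in>cball 0 (1 / 2). W y \<le> W x"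
      by (intro continuous_attains_sup) auto
    then obtain x0 where x0: "norm x0 \<le> 1 / 2" and max: "\<And>y. norm y \<le> 1 / 2 \<Longrightarrow> W y \<le> W x0"
      by (auto simp: dist_norm)
    have x0S: "x0 \<in> ball 0 1" using x0 by simp
    define p where "p = norm (grad u x0)"
    define q where "q = (1 / 4 - x0 \<bullet> x0) * p"
    \<comment> \<open>comparing \<open>W\<close> at the centre, where the cutoff is \<open>1/4\<close>, with its maximum\<close>
    have "norm (grad u 0) / 4 + n * L \<le> W 0" using w2(1)[of 0] by (simp add: W_def)
    also have "\<dots> \<le> W x0" using max[of 0] by simp
    also have "\<dots> \<le> q + 4 * n * L" using w2(2)[OF x0S] by (simp add: W_def q_def p_def)
    finally have gq: "norm (grad u 0) \<le> 4 * q + 12 * (n * L)" by (simp add: algebra_simps)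
    have "q \<le> n * L \<or> q \<le> (M K)\<^sup>2 * L\<^sup>2"
    proof (rule disjCI)
      assume "\<not> q \<le> (M K)\<^sup>2 * L\<^sup>2"
      show "q \<le> n * L"
      proof (rule ccontr)
        assume "\<not> q \<le> n * L"
        moreover have "0 < n * L" using n1 L1 by simp
        ultimately have big: "n * L \<le> q" and q0: "q > 0" by linarith+
        have p0: "p > 0" using q0 by (auto simp: q_def p_def zero_less_mult_iff)
        have "norm x0 \<noteq> 1 / 2"
        proof
          assume half: "norm x0 = 1 / 2"
          have "x0 \<bullet> x0 = 1 / 4" unfolding dot_square_norm half by (simp add: power2_eq_square)
          then have "q = 0" unfolding q_def by simp
          then show False using q0 by simp
        qed
        then have x0': "norm x0 < 1 / 2" using x0 by simp
        \<comment> \<open>\<open>Du \<bullet> e\<close> is at most \<open>|Du|\<close>, with equality at \<open>x0\<close>, so the maximum survives freezing \<open>e\<close>\<close>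
        define e where "e = (1 / p) *\<^sub>R grad u x0"
        have e: "norm e = 1" and ge: "grad u x0 = p *\<^sub>R e"
          using p0 by (simp_all add: e_def p_def)
        have max': "(1 / 4 - x \<bullet> x) * (grad u x \<bullet> e) + n / L * (u x - c)\<^sup>2
            \<le> (1 / 4 - x0 \<bullet> x0) * p + n / L * (u x0 - c)\<^sup>2" if x: "norm x < 1 / 2" for x
        proof -
          have "(norm x)\<^sup>2 \<le> (1 / 2)\<^sup>2" using x by (intro power_mono) auto
          then have "0 \<le> 1 / 4 - x \<bullet> x" by (simp add: dot_square_norm power2_eq_square)
          moreover have "grad u x \<bullet> e \<le> norm (grad u x)"
            using norm_cauchy_schwarz[of "grad u x" e] e by simp
          ultimately have "(1 / 4 - x \<bullet> x) * (grad u x \<bullet> e) \<le> (1 / 4 - x \<bullet> x) * norm (grad u x)"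
            by (intro mult_left_mono)
          then show ?thesis using max[of x] x by (simp add: W_def p_def)
        qed
        have "sqrt q \<le> M K * L"
          unfolding q_def M_def n_def
          by (rule interior_max_estimate[OF u3 \<psi> _ _ K x0' e ge L1 w[OF x0S]])
            (use eq low big max' in \<open>auto simp: n_def q_def\<close>)
        then have "(sqrt q)\<^sup>2 \<le> (M K * L)\<^sup>2"
          using q0 by (intro power_mono) auto
        then show False
          using \<open>\<not> q \<le> (M K)\<^sup>2 * L\<^sup>2\<close> q0 by (simp add: power_mult_distrib)
      qed
    qed
    moreover have LL: "L \<le> L\<^sup>2" using L1 by (simp add: power2_eq_square)
    then have nLL: "n * L \<le> n * L\<^sup>2" using n1 by (intro mult_left_mono) auto
    moreover have "0 \<le> (M K)\<^sup>2 * L\<^sup>2" "0 \<le> n * L\<^sup>2" using n1 by auto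
    ultimately have "q \<le> (M K)\<^sup>2 * L\<^sup>2 + n * L\<^sup>2" by linarith
    then have "norm (grad u 0) \<le> 4 * ((M K)\<^sup>2 * L\<^sup>2) + 16 * (n * L\<^sup>2)"
      using gq nLL by linarith
    also have "\<dots> = (4 * (M K)\<^sup>2 + 16 * n) * L\<^sup>2" by (simp add: algebra_simps)
    also have "\<dots> \<le> (4 * (M K)\<^sup>2 + 16 * n) * (2 * (1 + (osc (ball 0 1) u)\<^sup>2))"
    proof (rule mult_left_mono)
      have "0 \<le> (1 - osc (ball 0 1) u)\<^sup>2" by simp
      then show "L\<^sup>2 \<le> 2 * (1 + (osc (ball 0 1) u)\<^sup>2)"
        by (simp add: L_def power2_eq_square algebra_simps)
    qed (use n1 in auto)
    finally show "norm (grad u 0)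
        \<le> (8 * (M (hessian_sup_norm (ball 0 1) \<psi>))\<^sup>2 + 32 * n) * (1 + (osc (ball 0 1) u)\<^sup>2)"
      by (simp add: K_def algebra_simps)
  qed
qed

end
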